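(* Let $n\ge1$. There exists a constant $C_n>0$ (depending only on $n$) such that for any $1\le p<\infty$, any $\nu\in A_p(\mathbb{R}^n)$ and any $u\in W^{2,p}(\mathbb{R}^n,\nu)$, we have $$\sup_{0<s<1}\sup_{\varepsilon>0}\left|c_{n,s}\int_{|y|>\varepsilon}\frac{u(x-y)-u(x)}{|y|^{n+2s}}\,dy\right|\le C_n\big(M(D^2u)(x)+Mu(x)\big)$$ for almost every $x\in\mathbb{R}^n$.
   Context: $c_{n,s}=\frac{4^s\Gamma(n/2+s)}{|\Gamma(-s)|\pi^{n/2}}$, with $\Gamma$ the Gamma function. Hardy–Littlewood maximal function: $Mu(x)=\sup_{B\ni x}\frac{1}{|B|}\int_B|u(y)|\,dy$, supremum over all balls $B\subset\mathbb{R}^n$ containing $x$; $M(D^2u)$ means $M$ applied to $|D^2u|$. Muckenhoupt weights: $\nu\in L^1_{\mathrm{loc}}(\mathbb{R}^n)$, $\nu>0$ a.e., is in $A_p(\mathbb{R}^n)$, $1<p<\infty$, if there is $C>0$ with $\big(\frac{1}{|B|}\int_B\nu\,dx\big)^{1/p}\big(\frac{1}{|B|}\int_B\nu^{1-p'}\,dx\big)^{1/p'}\le C$ for every ball $B$, where $1/p+1/p'=1$; it is in $A_1(\mathbb{R}^n)$ if there is $C>0$ with $M\nu(x)\le C\nu(x)$ for a.e. $x$. $L^p(\mathbb{R}^n,\nu)$ is the $L^p$ space with respect to $\nu(x)\,dx$, and $W^{2,p}(\mathbb{R}^n,\nu)=\{u\in L^p(\mathbb{R}^n,\nu):\nabla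 u,D^2u\in L^p(\mathbb{R}^n,\nu)\}$ (distributional derivatives). *)

theory Defs
  imports "HOL-Analysis.Analysis"
begin

definition frac_laplacian_const :: "nat \<Rightarrow> real \<Rightarrow> real" where
  "frac_laplacian_const n s =
     4 powr s * Gamma (real n / 2 + s) / (\<bar>Gamma (- s)\<bar> * pi powr (real n / 2))"

text \<open>The maximal function takes values in the extended nonnegative reals, since the supremum may
  be infinite. On matrices, i.e. on \<^typ>\<open>real^'n^'n\<close>, \<^const>\<open>norm\<close> is the Frobenius norm.\<close>

definition maximal_function :: "(real^'n \<Rightarrow> 'b::real_normed_vector) \<Rightarrow> real^'n \<Rightarrow> ennreal" where
  "maximal_function f x =
     (SUP B\<in>{ball z r | z r. x \<in> ball z r}.
        (\<integral>\<^sup>+y\<in>B. ennreal (norm (f y)) \<partial>lebesgue) / emeasure lebesgue B)"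

definition locally_integrable :: "(real^'n \<Rightarrow> real) \<Rightarrow> bool" where
  "locally_integrable f \<longleftrightarrow> (\<forall>K. compact K \<longrightarrow> set_integrable lebesgue K f)"

definition ball_average :: "real^'n \<Rightarrow> real \<Rightarrow> (real^'n \<Rightarrow> real) \<Rightarrow> real" where
  "ball_average z r f = (LINT y:ball z r|lebesgue. f y) / measure lebesgue (ball z r)"

text \<open>For \<open>1 < p\<close> the two averages are real-valued integrals, which the library sets to \<open>0\<close> when the
  integrand is not integrable. So the finiteness of the average of \<open>\<nu> powr (1 - p')\<close>, which
  the bound by \<open>C\<close> entails mathematically, is required explicitly.\<close>

definition muckenhoupt :: "real \<Rightarrow> (real^'n \<Rightarrow> real) set" where
  "muckenhoupt p = {\<nu>. locally_integrable \<nu> \<and> (AE x in lebesgue. 0 < \<nu> x) \<and>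
     (p = 1 \<and> (\<exists>C>0. AE x in lebesgue. maximal_function \<nu> x \<le> ennreal (C * \<nu> x)) \<or>
      1 < p \<and> (let p' = p / (p - 1) in
        \<exists>C>0. \<forall>z. \<forall>r>0.
          set_integrable lebesgue (ball z r) (\<lambda>y. \<nu> y powr (1 - p')) \<and>
          ball_average z r \<nu> powr (1 / p) *
            ball_average z r (\<lambda>y. \<nu> y powr (1 - p')) powr (1 / p') \<le> C))}"

definition weighted_Lp ::
    "real \<Rightarrow> (real^'n \<Rightarrow> real) \<Rightarrow> (real^'n \<Rightarrow> 'b::real_normed_vector) set" where
  "weighted_Lp p \<nu> = {f \<in> borel_measurable lebesgue.
     integrable (density lebesgue (\<lambda>x. ennreal (\<nu> x))) (\<lambda>x. norm (f x) powr p)}"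

definition partial_deriv :: "'n \<Rightarrow> (real^'n \<Rightarrow> real) \<Rightarrow> real^'n \<Rightarrow> real" where
  "partial_deriv i f x = frechet_derivative f (at x) (axis i 1)"

abbreviation partial_derivs :: "'n list \<Rightarrow> (real^'n \<Rightarrow> real) \<Rightarrow> real^'n \<Rightarrow> real" where
  "partial_derivs is f \<equiv> foldr partial_deriv is f"

text \<open>Differentiability of all iterated partial derivatives makes each of them continuous, so the
  first conjunct says that \<open>\<phi>\<close> is infinitely differentiable.\<close>

definition test_function :: "(real^'n \<Rightarrow> real) \<Rightarrow> bool" where
  "test_function \<phi> \<longleftrightarrow>
     (\<forall>is x. partial_derivs is \<phi> differentiable (at x)) \<and> compact (closure {x. \<phi> x \<noteq> 0})"

definition distributional_deriv ::
    "'n list \<Rightarrow> (real^'n \<Rightarrow> real) \<Rightarrow> (real^'n \<Rightarrow> real) \<Rightarrow> bool" where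
  "distributional_deriv is u v \<longleftrightarrow> locally_integrable u \<and> locally_integrable v \<and>
     (\<forall>\<phi>. test_function \<phi> \<longrightarrow>
        (LINT x|lebesgue. u x * partial_derivs is \<phi> x)
          = (-1) ^ length is * (LINT x|lebesgue. v x * \<phi> x))"

definition distributional_gradient :: "(real^'n \<Rightarrow> real) \<Rightarrow> (real^'n \<Rightarrow> real^'n) \<Rightarrow> bool" where
  "distributional_gradient u G \<longleftrightarrow> (\<forall>i. distributional_deriv [i] u (\<lambda>x. G x $ i))"

definition distributional_hessian :: "(real^'n \<Rightarrow> real) \<Rightarrow> (real^'n \<Rightarrow> real^'n^'n) \<Rightarrow> bool" where
  "distributional_hessian u H \<longleftrightarrow> (\<forall>i j. distributional_deriv [i, j] u (\<lambda>x. H x $ i $ j))"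

definition weighted_sobolev2 :: "real \<Rightarrow> (real^'n \<Rightarrow> real) \<Rightarrow> (real^'n \<Rightarrow> real) set" where
  "weighted_sobolev2 p \<nu> = {u \<in> weighted_Lp p \<nu>.
     (\<exists>G\<in>weighted_Lp p \<nu>. distributional_gradient u G) \<and>
     (\<exists>H\<in>weighted_Lp p \<nu>. distributional_hessian u H)}"

end

theory Submission
  imports Defs
begin

text \<open>Write \<open>n = CARD('n)\<close> and let \<open>D r\<close> be the integral of \<open>u (x - y) - u x\<close> over \<open>ball 0 r\<close>.
  The kernel is a superposition of ball indicators,
  \<open>norm y powr (- a) = (integral over r > norm y of a * r powr (- a - 1))\<close> with \<open>a = n + 2 * s\<close>,
  so by Fubini the truncated integral is the integral of \<open>D r - D \<epsilon>\<close> over \<open>r > \<epsilon>\<close> against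
  \<open>a * r powr (- a - 1) dr\<close> (\<open>layer_cake_truncated\<close>). Everything follows from two bounds:

  \<^item> \<open>\<bar>D r\<bar> \<le> const * r ^ (n + 2) * M(D\<^sup>2u)(x)\<close>, used for small \<open>r\<close>. Cancellation of the first-order term
    is built in, because only integrals over centred balls occur (\<open>ball_integral_taylor\<close>).
  \<^item> \<open>\<bar>D r\<bar> \<le> const * r ^ n * Mu(x)\<close>, used for large \<open>r\<close>
    (\<open>ball_integral_le_maximal_function\<close>, \<open>abs_le_maximal_function\<close>).

  Integrating them over \<open>r \<le> 1\<close> and \<open>r \<ge> 1\<close> gives factors \<open>1 / (1 - s)\<close> and \<open>1 / s\<close>
  (\<open>nn_integral_two_scales\<close>), and both are absorbed by the normalising constant, which is
  \<open>O(s * (1 - s))\<close> (\<open>frac_laplacian_const_bound\<close>).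

  The first bound is a Taylor estimate for ball averages. For smooth \<open>u\<close> the derivative in \<open>t\<close> of the
  average over \<open>ball x t\<close> is \<open>t\<close> times the integral of the Laplacian of \<open>u\<close> against
  a constant multiple of \<open>(1 - \<bar>z - x\<bar>\<^sup>2 / t\<^sup>2) / t ^ n\<close>, cut off outside the ball. For a
  distributional Hessian this is applied to explicit smooth test functions (\<open>cap\<close>) and then passed to the limit in which the
  smoothed indicators become sharp (\<open>ball_integral_difference\<close>). It compares the averages over two
  radii; to compare with \<open>u x\<close> itself, the smaller radius is sent to \<open>0\<close> along a sequence on which
  the averages converge to \<open>u x\<close>. Such a sequence exists for almost every \<open>x\<close>, because averages over small
  balls converge in \<open>L\<^sup>1\<close> (\<open>locally_integrable_ball_average_subseq\<close>).

  The weight enters only through absolute convergence: the \<open>A\<^sub>p\<close> condition forces the integral of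
  \<open>\<bar>u\<bar>\<close> over \<open>ball x r\<close> to grow at most like \<open>r ^ n\<close> (\<open>muckenhoupt_ball_growth\<close>), whence the
  truncated integral exists at every point.\<close>

section \<open>The normalising constant\<close>

text \<open>Since \<open>Gamma (2 - s) = - s * (1 - s) * Gamma (- s)\<close>, the factor \<open>1 / \<bar>Gamma (- s)\<bar>\<close> vanishes to
  first order at both endpoints; what remains after dividing by \<open>s * (1 - s)\<close> is continuous on
  \<open>{0..1}\<close>, hence bounded.\<close>

lemma frac_laplacian_const_bound:
  assumes n: "n \<ge> 1"
  shows "\<exists>C>0. \<forall>s\<in>{0<..<1}. 0 \<le> frac_laplacian_const n s \<and>
    frac_laplacian_const n s \<le> C * (s * (1 - s))"
proof -
  define f where "f s = 4 powr s * Gamma (n / 2 + s) / (Gamma (2 - s) * pi powr (n / 2))" for s :: real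
  have pos: "Gamma (n / 2 + s) > 0" "Gamma (2 - s) > 0" if "s \<in> {0..1}" for s :: real
    using that n by (auto intro!: Gamma_real_pos)
  have "continuous_on {0..1} (\<lambda>s. Gamma (n / 2 + s))"
    by (rule continuous_on_compose2[OF continuous_on_Gamma[of "- \<int>\<^sub>\<le>\<^sub>0"]])
      (use n in \<open>auto intro!: continuous_intros dest: nonpos_Ints_nonpos\<close>)
  moreover have "continuous_on {0..1} (\<lambda>s::real. Gamma (2 - s))"
    by (rule continuous_on_compose2[OF continuous_on_Gamma[of "- \<int>\<^sub>\<le>\<^sub>0"]])
      (use n in \<open>auto intro!: continuous_intros dest: nonpos_Ints_nonpos\<close>)
  moreover have "continuous_on {0..1} (\<lambda>s::real. 4 powr s)"
    by (intro continuous_intros) auto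
  moreover have "Gamma (2 - s) * pi powr (n / 2) \<noteq> 0" if "s \<in> {0..1}" for s :: real
    using pos(2)[OF that] by simp
  ultimately have "continuous_on {0..1} f"
    unfolding f_def by (intro continuous_on_divide continuous_on_mult continuous_on_const) auto
  then have "bounded (f ` {0..1})"
    by (intro compact_imp_bounded compact_continuous_image) auto
  then obtain C where C: "C > 0" "\<And>s. s \<in> {0..1} \<Longrightarrow> \<bar>f s\<bar> \<le> C"
    unfolding bounded_pos by auto
  have eq: "frac_laplacian_const n s = f s * (s * (1 - s))" if "s \<in> {0<..<1}" for s
  proof -
    have "x \<notin> \<int>\<^sub>\<le>\<^sub>0" if "x > -1" "x \<noteq> 0" for x :: real
      using that by (auto elim!: nonpos_Ints_cases)
    then have "Gamma (2 - s) = (1 - s) * (- s * Gamma (- s))"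
      using that Gamma_plus1[of "1 - s"] Gamma_plus1[of "- s"] by (simp add: algebra_simps)
    then have G: "Gamma (2 - s) = s * (1 - s) * - Gamma (- s)" by (simp add: mult_ac)
    have "0 < s * (1 - s)" using that by simp
    moreover have "0 < Gamma (2 - s)" using pos that by simp
    ultimately have "0 < - Gamma (- s)"
      unfolding G by (simp only: zero_less_mult_pos)
    moreover have "4 powr s * a / (\<bar>b\<bar> * c) = 4 powr s * a / (k * - b * c) * k"
      if "0 < k" "0 < - b" for a b c k :: real
      using that by (simp add: abs_if)
    ultimately show ?thesis
      unfolding frac_laplacian_const_def f_def G using \<open>0 < s * (1 - s)\<close> by blast
  qed
  have "0 \<le> f s" if "s \<in> {0..1}" for s
    using pos[OF that] by (simp add: f_def)
  with C eq show ?thesis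
    by (intro exI[of _ C]) (auto intro!: mult_right_mono mult_nonneg_nonneg order.trans[OF abs_ge_self])
qed

section \<open>Balls, reflections and local integrability\<close>

lemma sigma_finite_lebesgue: "sigma_finite_measure (lebesgue :: 'a::euclidean_space measure)"
proof
  obtain A :: "'a set set" where "countable A" "A \<subseteq> sets lborel" "\<Union>A = space lborel" "\<forall>a\<in>A. emeasure lborel a \<noteq> \<infinity>"
    using lborel.sigma_finite_countable by metis
  then show "\<exists>A::'a set set. countable A \<and> A \<subseteq> sets lebesgue \<and> \<Union>A = space lebesgue \<and> (\<forall>a\<in>A. emeasure lebesgue a \<noteq> \<infinity>)"
    by (intro exI[of _ A]) (auto simp: subset_iff)
qed

lemma emeasure_lebesgue_ball:
  fixes z :: "real^'n"
  assumes "0 \<le> r"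
  shows "emeasure lebesgue (ball z r) = ennreal (unit_ball_vol CARD('n) * r ^ CARD('n))"
  using emeasure_ball[OF assms, of z] by simp

lemma measure_lebesgue_ball:
  fixes z :: "real^'n"
  assumes "0 \<le> r"
  shows "measure lebesgue (ball z r) = unit_ball_vol CARD('n) * r ^ CARD('n)"
  using content_ball[OF assms, of z] by simp

lemma nn_integral_ball_le_maximal_function:
  fixes z :: "real^'n"
  assumes "x \<in> ball z r"
  shows "(\<integral>\<^sup>+y\<in>ball z r. ennreal (norm (f y)) \<partial>lebesgue)
    \<le> maximal_function f x * ennreal (unit_ball_vol CARD('n) * r ^ CARD('n))"
proof -
  let ?I = "\<integral>\<^sup>+y\<in>ball z r. ennreal (norm (f y)) \<partial>lebesgue" and ?B = "emeasure lebesgue (ball z r)"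
  have r: "0 < r" using assms by (metis ball_empty empty_iff not_le)
  then have B: "?B = ennreal (unit_ball_vol CARD('n) * r ^ CARD('n))"
    by (intro emeasure_lebesgue_ball) simp
  then have B0: "0 < ?B" "?B < top" using r by (simp_all add: unit_ball_vol_pos)
  have "?I / ?B \<le> maximal_function f x"
    unfolding maximal_function_def using assms by (intro SUP_upper) auto
  then have "?I / ?B * ?B \<le> maximal_function f x * ?B" by (rule mult_right_mono) simp
  moreover have "?I / ?B * ?B = ?I"
    using B0 by (simp add: ennreal_divide_times ennreal_mult_divide_eq)
  ultimately show ?thesis by (simp add: B)
qed

lemma lebesgue_distr_reflect:
  fixes x :: "real^'n"
  shows "distr lebesgue lebesgue (\<lambda>y. x - y) = lebesgue" and "(\<lambda>y. x - y) \<in> lebesgue \<rightarrow>\<^sub>M lebesgue"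
proof -
  have eq: "x + (\<Sum>j\<in>Basis. (- 1 * (y \<bullet> j)) *\<^sub>R j) = x - y" for y :: "real^'n"
    by (simp add: sum_negf euclidean_representation)
  have "(lebesgue :: (real^'n) measure) = density (distr lebesgue lebesgue (\<lambda>y. x - y)) (\<lambda>_. 1)"
    using lebesgue_affine_euclidean[of "\<lambda>_. -1" x] unfolding eq by simp
  then show "distr lebesgue lebesgue (\<lambda>y. x - y) = lebesgue"
    by (simp add: density_1)
  show "(\<lambda>y. x - y) \<in> lebesgue \<rightarrow>\<^sub>M lebesgue"
    using lebesgue_affine_measurable[of "\<lambda>_. -1" x] unfolding eq by simp
qed

lemma nn_integral_lebesgue_reflect:
  fixes x :: "real^'n"
  assumes "f \<in> borel_measurable lebesgue"
  shows "(\<integral>\<^sup>+y. f (x - y) \<partial>lebesgue) = (\<integral>\<^sup>+y. f y \<partial>lebesgue)"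
  using nn_integral_distr[OF lebesgue_distr_reflect(2), of f x] assms
  by (simp add: lebesgue_distr_reflect(1))

lemma integral_lebesgue_reflect:
  fixes x :: "real^'n" and f :: "real^'n \<Rightarrow> real"
  assumes "f \<in> borel_measurable lebesgue"
  shows "(LINT y|lebesgue. f (x - y)) = (LINT y|lebesgue. f y)"
  using integral_distr[OF lebesgue_distr_reflect(2), of f x] assms
  by (simp add: lebesgue_distr_reflect(1))

lemma locally_integrable_borel_measurable:
  assumes "locally_integrable u"
  shows "u \<in> borel_measurable lebesgue"
proof (rule borel_measurable_LIMSEQ_metric)
  show "(\<lambda>x. indicator (cball 0 (real k)) x *\<^sub>R u x) \<in> borel_measurable lebesgue" for k
    using assms unfolding locally_integrable_def set_integrable_def
    by (intro borel_measurable_integrable) simp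
  show "(\<lambda>k. indicator (cball 0 (real k)) x *\<^sub>R u x) \<longlonglongrightarrow> u x" for x
  proof (rule tendsto_eventually)
    show "\<forall>\<^sub>F k in sequentially. indicator (cball 0 (real k)) x *\<^sub>R u x = u x"
      using eventually_ge_at_top[of "nat \<lceil>norm x\<rceil>"] 
      by eventually_elim (auto simp: indicator_def nat_le_iff ceiling_le_iff)
  qed
qed

lemma locally_integrable_ball:
  assumes "locally_integrable u"
  shows "set_integrable lebesgue (ball z r) u"
  using assms unfolding locally_integrable_def
  by (rule_tac set_integrable_subset[of _ "cball z r"]) auto

text \<open>The form in which test functions and their derivatives are paired with \<open>u\<close>: bounded and
  vanishing off a ball.\<close>

lemma locally_integrable_mult:
  fixes u :: "real^'n \<Rightarrow> real"
  assumes u: "locally_integrable u" and g: "g \<in> borel_measurable lebesgue"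
    and supp: "\<And>z. z \<notin> cball x r \<Longrightarrow> g z = 0" and bd: "\<And>z. \<bar>g z\<bar> \<le> B"
  shows "integrable lebesgue (\<lambda>z. u z * g z)"
proof (rule Bochner_Integration.integrable_bound)
  show "integrable lebesgue (\<lambda>z. B * (indicator (cball x r) z *\<^sub>R u z))"
    using u unfolding locally_integrable_def set_integrable_def by auto
  show "(\<lambda>z. u z * g z) \<in> borel_measurable lebesgue"
    using locally_integrable_borel_measurable[OF u] g by simp
  have "0 \<le> B" using bd[of x] by (meson abs_ge_zero order.trans)
  have "\<bar>u z * g z\<bar> \<le> \<bar>B * (indicator (cball x r) z *\<^sub>R u z)\<bar>" for z
    using supp[of z] bd[of z] \<open>0 \<le> B\<close>
    by (cases "z \<in> cball x r") (auto simp: abs_mult mult.commute[of B] intro!: mult_left_mono)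
  then show "AE z in lebesgue. norm (u z * g z) \<le> norm (B * (indicator (cball x r) z *\<^sub>R u z))"
    by simp
qed

lemma (in pair_sigma_finite) integrable_times:
  fixes f :: "'a \<Rightarrow> real" and g :: "'b \<Rightarrow> real"
  assumes f: "integrable M1 f" and g: "integrable M2 g"
  shows "integrable (M1 \<Otimes>\<^sub>M M2) (\<lambda>p. f (fst p) * g (snd p))"
proof -
  note [measurable] = borel_measurable_integrable[OF f] borel_measurable_integrable[OF g]
  have "integrable (M1 \<Otimes>\<^sub>M M2) (\<lambda>(x, y). f x * g y)"
    by (rule Fubini_integrable) (use f g in \<open>auto simp: abs_mult\<close>)
  then show ?thesis by (simp add: case_prod_beta')
qed

section \<open>Smooth radial test functions\<close>

text \<open>The functions \<open>x powr (- m) * exp (- 1 / x)\<close>, extended by zero. Every derivative of the classical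
  cut-off \<open>exp (- 1 / x)\<close> is a linear combination of them.\<close>

definition flat_exp :: "nat \<Rightarrow> real \<Rightarrow> real" where
  "flat_exp m x = (if 0 < x then (1 / x) ^ m * exp (- (1 / x)) else 0)"

lemma flat_exp_nonneg: "0 \<le> flat_exp m x"
  by (simp add: flat_exp_def)

lemma flat_exp_le_fact: "flat_exp m x \<le> fact m"
proof (cases "0 < x")
  case True
  then have "(\<Sum>n\<in>{m}. (1 / x) ^ n /\<^sub>R fact n) \<le> exp (1 / x)"
    unfolding exp_def by (intro sum_le_suminf summable_exp_generic) auto
  then show ?thesis
    using True by (simp add: flat_exp_def exp_minus divide_simps mult_ac)
qed (simp add: flat_exp_def)

text \<open>The family is closed under differentiation, also at the origin, where the difference quotient
  \<open>flat_exp m h / h\<close> equals \<open>h * flat_exp (m + 2) h\<close> and so tends to \<open>0\<close>.\<close>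

lemma flat_exp_has_real_derivative:
  "(flat_exp m has_real_derivative flat_exp (m + 2) x - m * flat_exp (m + 1) x) (at x)"
proof -
  consider "x < 0" | "x = 0" | "0 < x" by linarith
  then show ?thesis
  proof cases
    case 1
    have "((\<lambda>x. 0) has_real_derivative 0) (at x)" by simp
    then have "(flat_exp m has_real_derivative 0) (at x)"
      by (rule has_field_derivative_transform_within_open[of _ _ _ "{..<0}"])
         (use 1 in \<open>auto simp: flat_exp_def\<close>)
    then show ?thesis using 1 by (simp add: flat_exp_def)
  next
    case 2
    have eq: "flat_exp m h / h = h * flat_exp (m + 2) h" for h
      by (auto simp: flat_exp_def field_simps power2_eq_square)
    have "((\<lambda>h. h * flat_exp (m + 2) h) \<longlongrightarrow> 0) (at 0)"
    proof (rule Lim_null_comparison)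
      show "\<forall>\<^sub>F h in at 0. norm (h * flat_exp (m + 2) h) \<le> \<bar>h\<bar> * fact (m + 2)"
        using flat_exp_le_fact[of "m+2"] flat_exp_nonneg[of "m+2"]
        by (intro always_eventually) (auto simp: abs_mult intro!: mult_left_mono)
      show "((\<lambda>h::real. \<bar>h\<bar> * fact (m + 2)) \<longlongrightarrow> 0) (at 0)"
        by (auto intro!: tendsto_eq_intros)
    qed
    then have "((\<lambda>h. flat_exp m h / h) \<longlongrightarrow> 0) (at 0)"
      unfolding eq .
    then show ?thesis
      using 2 by (simp add: DERIV_def flat_exp_def)
  next
    case 3
    have "((\<lambda>x. (1 / x) ^ m * exp (- (1 / x))) has_real_derivative
        (1/x) ^ (m + 2) * exp (- (1/x)) - m * ((1/x) ^ (m + 1) * exp (- (1/x)))) (at x)"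
    proof (cases m)
      case 0
      then show ?thesis
        using 3 by (auto intro!: derivative_eq_intros simp: power2_eq_square)
    next
      case (Suc j)
      have inv: "((\<lambda>x. 1 / x) has_real_derivative - ((1 / x)\<^sup>2)) (at x)"
        using 3 by (auto intro!: derivative_eq_intros simp: power2_eq_square)
      have d1: "((\<lambda>x. (1 / x) ^ m) has_real_derivative - (m * (1 / x) ^ (m + 1))) (at x)"
        unfolding Suc
        by (rule DERIV_cong[OF DERIV_power_Suc[OF inv, of j]]) (simp add: power2_eq_square)
      have d2: "((\<lambda>x. exp (- (1 / x))) has_real_derivative exp (- (1 / x)) * (1 / x)\<^sup>2) (at x)"
        by (rule DERIV_cong[OF DERIV_fun_exp[OF DERIV_minus[OF inv]]]) simp
      have "- (m * v ^ (m + 1)) * e + e * v\<^sup>2 * v ^ m = v ^ (m + 2) * e - m * (v ^ (m + 1) * e)"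
        for v e :: real
        by (simp add: power_add power2_eq_square algebra_simps)
      then show ?thesis
        by (rule DERIV_cong[OF DERIV_mult[OF d1 d2]])
    qed
    then have "(flat_exp m has_real_derivative
        (1/x) ^ (m + 2) * exp (- (1/x)) - m * ((1/x) ^ (m + 1) * exp (- (1/x)))) (at x)"
      by (rule has_field_derivative_transform_within_open[of _ _ _ "{0<..}"])
         (use 3 in \<open>auto simp: flat_exp_def\<close>)
    then show ?thesis using 3 by (simp add: flat_exp_def)
  qed
qed

text \<open>A smooth positive part: \<open>ramp\<close> vanishes on the negative axis, \<open>0 \<le> ramp x \<le> x\<close> on the positive
  one, and \<open>x \<mapsto> ramp (k * x) / k\<close> tends to \<open>max 0 x\<close> as \<open>k\<close> grows. Its derivative is a smooth step
  with values in \<open>{0..1}\<close>, and \<open>x \<mapsto> ramp' (k * x)\<close> tends to the indicator of \<open>{0<..}\<close>.\<close>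

definition ramp :: "real \<Rightarrow> real" where "ramp x = x * flat_exp 0 x"
definition ramp' :: "real \<Rightarrow> real" where "ramp' x = flat_exp 0 x + flat_exp 1 x"

lemma ramp_has_real_derivative: "(ramp has_real_derivative ramp' x) (at x)"
proof -
  have "(ramp has_real_derivative (1 * flat_exp 0 x + (flat_exp (0+2) x - real 0 * flat_exp (0+1) x) * x)) (at x)"
    unfolding ramp_def[abs_def] by (intro DERIV_mult flat_exp_has_real_derivative DERIV_ident)
  moreover have "flat_exp 2 x * x = flat_exp 1 x"
    by (simp add: flat_exp_def power2_eq_square)
  ultimately show ?thesis by (simp add: ramp'_def numeral_2_eq_2)
qed

lemma ramp'_has_real_derivative: "(ramp' has_real_derivative flat_exp 3 x) (at x)"
  unfolding ramp'_def[abs_def]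
  by (rule DERIV_cong[OF DERIV_add[OF flat_exp_has_real_derivative flat_exp_has_real_derivative]])
    (simp add: numeral_2_eq_2 numeral_3_eq_3)

lemma ramp'_bounds: "0 \<le> ramp' x" "ramp' x \<le> 1"
proof -
  show "0 \<le> ramp' x" by (simp add: ramp'_def flat_exp_nonneg)
  have "(1 + 1 / x) * exp (- (1 / x)) \<le> exp (1 / x) * exp (- (1 / x))"
    by (intro mult_right_mono exp_ge_add_one_self) auto
  then show "ramp' x \<le> 1"
    by (simp add: ramp'_def flat_exp_def ring_distribs flip: exp_add)
qed

lemma ramp_bounds: "0 \<le> ramp x" "ramp x \<le> max 0 x"
  by (auto simp: ramp_def flat_exp_def)

lemma ramp_eq_0: "x \<le> 0 \<Longrightarrow> ramp x = 0" by (simp add: ramp_def flat_exp_def)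
lemma ramp'_eq_0: "x \<le> 0 \<Longrightarrow> ramp' x = 0" by (simp add: ramp'_def flat_exp_def)

lemma ramp'_tendsto: "0 < x \<Longrightarrow> (\<lambda>k. ramp' (real k * x)) \<longlonglongrightarrow> 1"
proof -
  assume x: "0 < x"
  have "(\<lambda>k. (1 + 1 / (real k * x)) * exp (- (1 / (real k * x)))) \<longlonglongrightarrow> (1 + 0) * exp (- 0)"
    using tendsto_mult_right_zero[OF lim_1_over_n[where 'a=real], of "1/x"]
    by (intro tendsto_intros) (simp_all add: field_simps)
  moreover have "\<forall>\<^sub>F k in sequentially. ramp' (real k * x) = (1 + 1 / (real k * x)) * exp (- (1 / (real k * x)))"
    using eventually_gt_at_top[of 0] by eventually_elim (use x in \<open>simp add: ramp'_def flat_exp_def ring_distribs\<close>)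
  ultimately show ?thesis by (simp add: tendsto_cong)
qed

text \<open>Test functions must have differentiable partial derivatives of all orders. This algebra is
  rich enough to contain the radial bumps and is stable under partial derivatives, so
  an induction on the order shows that its members are smooth.\<close>

inductive_set radial_algebra :: "real \<Rightarrow> real \<Rightarrow> real^'n \<Rightarrow> (real^'n \<Rightarrow> real) set"
  for a b :: real and x :: "real^'n" where
  const: "(\<lambda>z. c) \<in> radial_algebra a b x"
| coord: "(\<lambda>z. (z - x) $ i) \<in> radial_algebra a b x"
| quad: "(\<lambda>z. a - b * (norm (z - x))\<^sup>2) \<in> radial_algebra a b x"
| flat_exp: "(\<lambda>z. flat_exp m (a - b * (norm (z - x))\<^sup>2)) \<in> radial_algebra a b x"
| add: "f \<in> radial_algebra a b x \<Longrightarrow> g \<in> radial_algebra a b x \<Longrightarrow> (\<lambda>z. f z + g z) \<in> radial_algebra a b x"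
| mult: "f \<in> radial_algebra a b x \<Longrightarrow> g \<in> radial_algebra a b x \<Longrightarrow> (\<lambda>z. f z * g z) \<in> radial_algebra a b x"

lemma quad_has_derivative:
  fixes x :: "'a::real_inner"
  shows "((\<lambda>z. a - b * (norm (z - x))\<^sup>2) has_derivative (\<lambda>h. - 2 * b * ((z - x) \<bullet> h))) (at z)"
  unfolding power2_norm_eq_inner
  by (auto intro!: derivative_eq_intros simp: algebra_simps inner_commute)

lemma radial_has_derivative:
  fixes x :: "'a::real_inner"
  assumes "\<And>s. (f has_real_derivative f' s) (at s)"
  shows "((\<lambda>z. f (a - b * (norm (z - x))\<^sup>2)) has_derivative
     (\<lambda>h. f' (a - b * (norm (z - x))\<^sup>2) * (- 2 * b * ((z - x) \<bullet> h)))) (at z)"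
  using has_derivative_compose[OF quad_has_derivative assms[THEN has_field_derivative_imp_has_derivative], of a b x z]
  by simp

lemma partial_derivI:
  assumes "\<And>z. (f has_derivative D z) (at z)"
  shows "partial_deriv i f = (\<lambda>z. D z (axis i 1))"
  unfolding partial_deriv_def using frechet_derivative_at[OF assms] by simp

lemma radial_algebra_has_derivative:
  assumes "f \<in> radial_algebra a b x"
  shows "\<exists>D. (\<forall>z. (f has_derivative D z) (at z)) \<and> (\<forall>i. (\<lambda>z. D z (axis i 1)) \<in> radial_algebra a b x)"
  using assms
proof induction
  case (const c)
  show ?case by (intro exI[of _ "\<lambda>_ _. 0"]) (auto intro: radial_algebra.const)
next
  case (coord j)
  have "((\<lambda>z. (z - x) $ j) has_derivative (\<lambda>h. h $ j)) (at z)" for z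
    by (auto intro!: derivative_eq_intros bounded_linear.has_derivative[OF bounded_linear_vec_nth])
  then show ?case
    by (intro exI[of _ "\<lambda>_ h. h $ j"]) (auto intro: radial_algebra.const)
next
  case quad
  have "(\<lambda>z. - 2 * b * ((z - x) $ i)) \<in> radial_algebra a b x" for i
    by (intro radial_algebra.mult radial_algebra.const radial_algebra.coord)
  then show ?case
    using quad_has_derivative[of a b x] 
    by (intro exI[of _ "\<lambda>z h. - 2 * b * ((z - x) \<bullet> h)"]) (simp add: inner_axis)
next
  case (flat_exp m)
  have "(\<lambda>z. (flat_exp (m + 2) (a - b * (norm (z - x))\<^sup>2) + - real m * flat_exp (m + 1) (a - b * (norm (z - x))\<^sup>2)) *
      (- 2 * b * ((z - x) $ i))) \<in> radial_algebra a b x" for i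
    by (intro radial_algebra.intros)
  then show ?case
    by (intro exI[of _ "\<lambda>z h. (flat_exp (m + 2) (a - b * (norm (z - x))\<^sup>2) - m * flat_exp (m + 1) (a - b * (norm (z - x))\<^sup>2))
       * (- 2 * b * ((z - x) \<bullet> h))"] conjI allI radial_has_derivative[OF flat_exp_has_real_derivative])
      (simp add: inner_axis)
next
  case (add f g)
  then obtain D E where "\<forall>z. (f has_derivative D z) (at z)" "\<forall>z. (g has_derivative E z) (at z)"
    "\<forall>i. (\<lambda>z. D z (axis i 1)) \<in> radial_algebra a b x" "\<forall>i. (\<lambda>z. E z (axis i 1)) \<in> radial_algebra a b x"
    by blast
  then show ?case
    by (intro exI[of _ "\<lambda>z h. D z h + E z h"]) (auto intro: has_derivative_add radial_algebra.add)
next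
  case (mult f g)
  then obtain D E where DE: "\<forall>z. (f has_derivative D z) (at z)" "\<forall>z. (g has_derivative E z) (at z)"
    "\<forall>i. (\<lambda>z. D z (axis i 1)) \<in> radial_algebra a b x" "\<forall>i. (\<lambda>z. E z (axis i 1)) \<in> radial_algebra a b x"
    by blast
  have "(\<lambda>z. f z * E z (axis i 1) + D z (axis i 1) * g z) \<in> radial_algebra a b x" for i
    using DE mult.hyps by (intro radial_algebra.add radial_algebra.mult) auto
  with DE(1,2) show ?case
    by (intro exI[of _ "\<lambda>z h. f z * E z h + D z h * g z"]) (auto intro: has_derivative_mult)
qed

lemma radial_algebra_partial_derivs:
  assumes "f \<in> radial_algebra a b x"
  shows "partial_derivs is f \<in> radial_algebra a b x"
proof (induction "is")
  case (Cons i "is")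
  then obtain D where D: "\<forall>z. (partial_derivs is f has_derivative D z) (at z)"
     "(\<lambda>z. D z (axis i 1)) \<in> radial_algebra a b x"
    using radial_algebra_has_derivative by blast
  then show ?case
    using partial_derivI[of "partial_derivs is f" D i] by simp
qed (use assms in simp)

lemma radial_algebra_test_function:
  assumes "f \<in> radial_algebra a b x" and "\<And>z. f z \<noteq> 0 \<Longrightarrow> z \<in> cball y r"
  shows "test_function f"
proof -
  have "closure {z. f z \<noteq> 0} \<subseteq> cball y r"
    using assms(2) by (intro closure_minimal) auto
  then have "compact (closure {z. f z \<noteq> 0})"
    using bounded_subset[OF bounded_cball] by (simp add: compact_eq_bounded_closed)
  then show ?thesis
    using radial_algebra_has_derivative[OF radial_algebra_partial_derivs[OF assms(1)]]
    unfolding test_function_def differentiable_def by blast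
qed

text \<open>A smooth version of half the paraboloid \<open>(1 - \<bar>z - x\<bar>\<^sup>2 / t\<^sup>2) / t ^ n\<close>, cut off at zero outside \<open>ball x t\<close>
  and approached as \<open>k\<close> grows. Its Laplacian is \<open>cap_laplacian\<close>, and \<open>smooth_ball\<close> is a smooth
  version of the indicator of \<open>ball x t\<close> divided by \<open>t ^ n\<close>. They are tied together by the identity
  \<open>d/dt smooth_ball = t * cap_laplacian\<close>, which holds because both sides are the divergence of
  the field \<open>- (z - x) / t * smooth_ball\<close>: the left side by scaling in \<open>t\<close>, the right side because
  the gradient of \<open>cap\<close> is \<open>- (z - x) / t\<^sup>2 * smooth_ball\<close>.\<close>

definition cap :: "real \<Rightarrow> real^'n \<Rightarrow> real \<Rightarrow> real^'n \<Rightarrow> real" where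
  "cap k x t z = ramp (k - k / t\<^sup>2 * (norm (z - x))\<^sup>2) / (2 * k * t ^ CARD('n))"

definition cap_laplacian :: "real \<Rightarrow> real^'n \<Rightarrow> real \<Rightarrow> real^'n \<Rightarrow> real" where
  "cap_laplacian k x t z = 
     (2 * k * (norm (z - x) / t)\<^sup>2 * flat_exp 3 (k - k / t\<^sup>2 * (norm (z - x))\<^sup>2)
      - CARD('n) * ramp' (k - k / t\<^sup>2 * (norm (z - x))\<^sup>2)) / t ^ (CARD('n) + 2)"

definition smooth_ball :: "real \<Rightarrow> real^'n \<Rightarrow> real \<Rightarrow> real^'n \<Rightarrow> real" where
  "smooth_ball k x t z = ramp' (k - k / t\<^sup>2 * (norm (z - x))\<^sup>2) / t ^ CARD('n)"

lemma cap_arg_nonpos: 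
  fixes x :: "'a::real_normed_vector"
  assumes "0 < k" "0 < t" "t \<le> norm (z - x)" shows "k - k / t\<^sup>2 * (norm (z - x))\<^sup>2 \<le> 0"
proof -
  have "t\<^sup>2 \<le> (norm (z - x))\<^sup>2" using assms by (intro power_mono) auto
  then show ?thesis using assms by (simp add: field_simps)
qed

lemma cap_test_function:
  assumes "0 < k" "0 < t"
  shows "test_function (cap k x t)"
proof (rule radial_algebra_test_function)
  have "(\<lambda>z. 1 / (2 * k * t ^ CARD('n)) * ((k - k / t\<^sup>2 * (norm (z - x))\<^sup>2) * flat_exp 0 (k - k / t\<^sup>2 * (norm (z - x))\<^sup>2)))
      \<in> radial_algebra k (k / t\<^sup>2) x"
    by (intro radial_algebra.intros)
  then show "cap k x t \<in> radial_algebra k (k / t\<^sup>2) x"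
    by (simp add: cap_def[abs_def] ramp_def)
  show "z \<in> cball x t" if "cap k x t z \<noteq> 0" for z
    using that cap_arg_nonpos[OF assms, of z x] by (force simp: cap_def ramp_eq_0 dist_norm norm_minus_commute)
qed

lemma partial_derivs_cap:
  fixes x :: "real^'n"
  assumes "0 < k" "0 < t"
  shows "partial_derivs [i, i] (cap k x t) z =
    (2 * k * ((z - x) $ i / t)\<^sup>2 * flat_exp 3 (k - k / t\<^sup>2 * (norm (z - x))\<^sup>2)
      - ramp' (k - k / t\<^sup>2 * (norm (z - x))\<^sup>2)) / t ^ (CARD('n) + 2)"
proof -
  let ?q = "\<lambda>z. k - k / t\<^sup>2 * (norm (z - x))\<^sup>2"
  let ?c = "2 * k * t ^ CARD('n)"
  have "(cap k x t has_derivative (\<lambda>h. ramp' (?q z) * (- 2 * (k / t\<^sup>2) * ((z - x) \<bullet> h)) / ?c)) (at z)" for z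
    unfolding cap_def[abs_def]
    by (intro bounded_linear.has_derivative[OF bounded_linear_divide]
        radial_has_derivative[OF ramp_has_real_derivative])
  note 1 = partial_derivI[OF this, of i]
  have l: "((\<lambda>z. - 2 * (k / t\<^sup>2) * ((z - x) \<bullet> axis i 1)) has_derivative
      (\<lambda>h. - 2 * (k / t\<^sup>2) * (h \<bullet> axis i 1))) (at z)" for z
    by (intro has_derivative_mult_right) (auto intro!: derivative_eq_intros)
  have "((\<lambda>z. ramp' (?q z) * (- 2 * (k / t\<^sup>2) * ((z - x) \<bullet> axis i 1)) / ?c) has_derivative
     (\<lambda>h. (ramp' (?q z) * (- 2 * (k / t\<^sup>2) * (h \<bullet> axis i 1)) +
         (flat_exp 3 (?q z) * (- 2 * (k / t\<^sup>2) * ((z - x) \<bullet> h))) * (- 2 * (k / t\<^sup>2) * ((z - x) \<bullet> axis i 1))) / ?c)) (at z)" for z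
    by (intro bounded_linear.has_derivative[OF bounded_linear_divide] has_derivative_mult l
        radial_has_derivative[OF ramp'_has_real_derivative])
  note 2 = partial_derivI[OF this, of i]
  show ?thesis
    unfolding foldr.simps comp_apply id_apply 1 2 using assms
    by (simp add: inner_axis) (simp add: field_simps power2_eq_square power4_eq_xxxx power_add)
qed

lemma sum_partial_derivs_cap:
  fixes x :: "real^'n"
  assumes "0 < k" "0 < t"
  shows "(\<Sum>i\<in>UNIV. partial_derivs [i, i] (cap k x t) z) = cap_laplacian k x t z"
proof -
  have "(norm (z - x))\<^sup>2 = (\<Sum>i\<in>UNIV. ((z - x) $ i)\<^sup>2)"
    unfolding power2_norm_eq_inner inner_vec_def by (simp add: power2_eq_square)
  then show ?thesis
    unfolding partial_derivs_cap[OF assms] cap_laplacian_def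
    by (simp add: sum_divide_distrib[symmetric] sum_subtractf sum_distrib_left sum_distrib_right power_divide 
       del: power2_norm_eq_inner)
qed

lemma smooth_ball_has_real_derivative:
  fixes x :: "real^'n"
  assumes "0 < k" "0 < t"
  shows "((\<lambda>t. smooth_ball k x t z) has_real_derivative t * cap_laplacian k x t z) (at t)"
proof -
  let ?r = "norm (z - x)"
  have q: "((\<lambda>t. k - k / t\<^sup>2 * ?r\<^sup>2) has_real_derivative 2 * k * ?r\<^sup>2 / t ^ 3) (at t)"
    using assms by (auto intro!: derivative_eq_intros simp: field_simps power2_eq_square power3_eq_cube)
  have p: "((\<lambda>t. 1 / t ^ CARD('n)) has_real_derivative - (CARD('n) / t ^ (CARD('n) + 1))) (at t)"
    using assms by (auto intro!: derivative_eq_intros simp: field_simps power2_eq_square 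
      simp flip: power_Suc power_add)
  have "((\<lambda>t. ramp' (k - k / t\<^sup>2 * ?r\<^sup>2) * (1 / t ^ CARD('n))) has_real_derivative 
      flat_exp 3 (k - k / t\<^sup>2 * ?r\<^sup>2) * (2 * k * ?r\<^sup>2 / t ^ 3) * (1 / t ^ CARD('n))
       + (- (CARD('n) / t ^ (CARD('n) + 1))) * ramp' (k - k / t\<^sup>2 * ?r\<^sup>2)) (at t)"
    by (intro DERIV_mult p DERIV_chain2[OF ramp'_has_real_derivative q])
  note d = this
  show ?thesis unfolding smooth_ball_def cap_laplacian_def
    using DERIV_cong[OF d, of "t * ((2 * k * (?r / t)\<^sup>2 * flat_exp 3 (k - k / t\<^sup>2 * ?r\<^sup>2) -
       real CARD('n) * ramp' (k - k / t\<^sup>2 * ?r\<^sup>2)) / t ^ (CARD('n) + 2))"] assms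
    by (simp add: field_simps power2_eq_square power3_eq_cube)
qed

section \<open>Ball averages are controlled by the Hessian\<close>

lemma measurable_profiles [measurable]:
  "flat_exp m \<in> borel_measurable borel" "ramp \<in> borel_measurable borel" "ramp' \<in> borel_measurable borel"
  using flat_exp_has_real_derivative ramp_has_real_derivative ramp'_has_real_derivative
  by (blast intro: borel_measurable_continuous_onI continuous_at_imp_continuous_on DERIV_isCont)+

lemma norm_diff_lebesgue_measurable [measurable]:
  fixes x :: "'a::euclidean_space"
  shows "(\<lambda>z. norm (z - x)) \<in> borel_measurable lebesgue"
  by (rule measurable_completion) simp

lemma cap_measurable [measurable]: "cap k x t \<in> borel_measurable lebesgue"
  unfolding cap_def[abs_def] by measurable

lemma smooth_ball_measurable [measurable]: "smooth_ball k x t \<in> borel_measurable lebesgue"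
  unfolding smooth_ball_def[abs_def] by measurable

lemma cap_laplacian_measurable [measurable]:
  "(\<lambda>p. cap_laplacian k x (snd p) (fst p)) \<in> borel_measurable (lebesgue \<Otimes>\<^sub>M lborel)"
  unfolding cap_laplacian_def[abs_def] by measurable

lemma cap_bounds:
  fixes x :: "real^'n"
  assumes "0 < k" "0 < t"
  shows "0 \<le> cap k x t z" "cap k x t z \<le> indicator (ball x t) z / (2 * t ^ CARD('n))"
proof -
  let ?q = "k - k / t\<^sup>2 * (norm (z - x))\<^sup>2"
  show "0 \<le> cap k x t z" using assms by (simp add: cap_def ramp_bounds)
  have "?q \<le> k" using assms by simp
  then have "ramp ?q \<le> k" using assms by (intro order.trans[OF ramp_bounds(2)]) simp
  then have "cap k x t z \<le> k / (2 * k * t ^ CARD('n))"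
    unfolding cap_def using assms by (intro divide_right_mono) auto
  moreover have "cap k x t z = 0" if "z \<notin> ball x t"
    using that cap_arg_nonpos[OF assms, of z x] by (simp add: cap_def ramp_eq_0 dist_norm norm_minus_commute)
  ultimately show "cap k x t z \<le> indicator (ball x t) z / (2 * t ^ CARD('n))"
    using assms by (cases "z \<in> ball x t") auto
qed

lemma smooth_ball_bounds:
  fixes x :: "real^'n"
  assumes "0 < k" "0 < t"
  shows "0 \<le> smooth_ball k x t z" "smooth_ball k x t z \<le> indicator (ball x t) z / t ^ CARD('n)"
proof -
  show "0 \<le> smooth_ball k x t z" using assms by (simp add: smooth_ball_def ramp'_bounds)
  have "smooth_ball k x t z = 0" if "z \<notin> ball x t"
    using that cap_arg_nonpos[OF assms, of z x] by (simp add: smooth_ball_def ramp'_eq_0 dist_norm norm_minus_commute)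
  moreover have "smooth_ball k x t z \<le> 1 / t ^ CARD('n)"
    unfolding smooth_ball_def using assms by (intro divide_right_mono ramp'_bounds) auto
  ultimately show "smooth_ball k x t z \<le> indicator (ball x t) z / t ^ CARD('n)"
    by (cases "z \<in> ball x t") auto
qed

lemma cap_laplacian_bound:
  fixes x :: "real^'n"
  assumes "0 < k" "0 < t"
  shows "\<bar>cap_laplacian k x t z\<bar> \<le> (12 * k + CARD('n)) / t ^ (CARD('n) + 2) * indicator (ball x t) z"
proof -
  let ?q = "k - k / t\<^sup>2 * (norm (z - x))\<^sup>2"
  show ?thesis
  proof (cases "z \<in> ball x t")
    case True
    then have "(norm (z - x) / t)\<^sup>2 \<le> 1"
      using assms by (simp add: dist_norm norm_minus_commute power_le_one)
    moreover have "flat_exp 3 ?q \<le> 6" using flat_exp_le_fact[of 3 ?q] by (simp add: fact_numeral)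
    ultimately have "(norm (z - x) / t)\<^sup>2 * flat_exp 3 ?q \<le> 1 * 6"
      using flat_exp_nonneg by (intro mult_mono) auto
    then have "2 * k * ((norm (z - x) / t)\<^sup>2 * flat_exp 3 ?q) \<le> 2 * k * 6"
      using assms by (intro mult_left_mono) auto
    moreover have "0 \<le> 2 * k * ((norm (z - x) / t)\<^sup>2 * flat_exp 3 ?q)"
      using assms flat_exp_nonneg by (intro mult_nonneg_nonneg) auto
    moreover have "CARD('n) * ramp' ?q \<le> CARD('n)" "0 \<le> CARD('n) * ramp' ?q"
      by (simp_all add: ramp'_bounds mult_left_le)
    ultimately have "\<bar>2 * k * (norm (z - x) / t)\<^sup>2 * flat_exp 3 ?q - CARD('n) * ramp' ?q\<bar> \<le> 12 * k + CARD('n)"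
      by (simp only: mult.assoc abs_le_iff) linarith
    then show ?thesis
      using True assms by (simp add: cap_laplacian_def abs_divide divide_right_mono)
  next
    case False
    then have "?q \<le> 0"
      using cap_arg_nonpos[OF assms, of z x] by (simp add: dist_norm norm_minus_commute)
    then show ?thesis
      using False by (simp add: cap_laplacian_def ramp'_eq_0 flat_exp_def)
  qed
qed

lemma integrable_mult_cap_derivs:
  fixes u :: "real^'n \<Rightarrow> real"
  assumes "locally_integrable u" "0 < k" "0 < t"
  shows "integrable lebesgue (\<lambda>z. u z * cap k x t z)"
    and "integrable lebesgue (\<lambda>z. u z * partial_derivs [i, i] (cap k x t) z)"
    and "integrable lebesgue (\<lambda>z. u z * smooth_ball k x t z)"
proof -
  show "integrable lebesgue (\<lambda>z. u z * cap k x t z)"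
  proof (rule locally_integrable_mult[OF assms(1)])
    fix z
    show "z \<notin> cball x t \<Longrightarrow> cap k x t z = 0" 
      using cap_bounds[OF assms(2,3), of x z] by (auto simp: indicator_def split: if_splits)
    show "\<bar>cap k x t z\<bar> \<le> 1 / (2 * t ^ CARD('n))"
      using cap_bounds[OF assms(2,3), of x z] assms
      by (simp add: order.trans[OF cap_bounds(2)] divide_right_mono indicator_def)
  qed auto
  show "integrable lebesgue (\<lambda>z. u z * smooth_ball k x t z)"
  proof (rule locally_integrable_mult[OF assms(1)])
    fix z
    show "z \<notin> cball x t \<Longrightarrow> smooth_ball k x t z = 0" 
      using smooth_ball_bounds[OF assms(2,3), of x z] by (auto simp: indicator_def split: if_splits)
    show "\<bar>smooth_ball k x t z\<bar> \<le> 1 / t ^ CARD('n)"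
      using smooth_ball_bounds[OF assms(2,3), of x z] assms
      by (simp add: order.trans[OF smooth_ball_bounds(2)] divide_right_mono indicator_def)
  qed auto
  show "integrable lebesgue (\<lambda>z. u z * partial_derivs [i, i] (cap k x t) z)"
  proof (rule locally_integrable_mult[OF assms(1)])
    have *: "(\<lambda>z::real^'n. (z - x) $ i) \<in> borel_measurable lebesgue"
      by (rule measurable_completion) simp
    show "(\<lambda>z. partial_derivs [i, i] (cap k x t) z) \<in> borel_measurable lebesgue"
      unfolding partial_derivs_cap[OF assms(2,3)] using * by measurable
    fix z
    let ?q = "k - k / t\<^sup>2 * (norm (z - x))\<^sup>2"
    show 0: "z \<notin> cball x t \<Longrightarrow> partial_derivs [i, i] (cap k x t) z = 0"
      unfolding partial_derivs_cap[OF assms(2,3)]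
      using cap_arg_nonpos[OF assms(2,3), of z x]
      by (simp add: ramp'_eq_0 flat_exp_def dist_norm norm_minus_commute)
    show "\<bar>partial_derivs [i, i] (cap k x t) z\<bar> \<le> (12 * k + 1) / t ^ (CARD('n) + 2)"
    proof (cases "z \<in> cball x t")
      case True
      have "\<bar>(z - x) $ i\<bar> \<le> t"
        using True component_le_norm_cart[of "z - x" i] by (simp add: dist_norm norm_minus_commute)
      then have "((z - x) $ i)\<^sup>2 \<le> t\<^sup>2"
        using assms by (subst power2_le_iff_abs_le) auto
      then have "((z - x) $ i / t)\<^sup>2 \<le> 1"
        using assms by (simp add: power_divide)
      moreover have "flat_exp 3 ?q \<le> 6" using flat_exp_le_fact[of 3 ?q] by (simp add: fact_numeral)
      ultimately have "((z - x) $ i / t)\<^sup>2 * flat_exp 3 ?q \<le> 1 * 6"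
        using flat_exp_nonneg by (intro mult_mono) auto
      then have "2 * k * (((z - x) $ i / t)\<^sup>2 * flat_exp 3 ?q) \<le> 2 * k * 6"
        using assms by (intro mult_left_mono) auto
      moreover have "0 \<le> 2 * k * (((z - x) $ i / t)\<^sup>2 * flat_exp 3 ?q)"
        using assms flat_exp_nonneg by (intro mult_nonneg_nonneg) auto
      ultimately have "\<bar>2 * k * ((z - x) $ i / t)\<^sup>2 * flat_exp 3 ?q - ramp' ?q\<bar> \<le> 12 * k + 1"
        using ramp'_bounds[of ?q] by (simp only: mult.assoc abs_le_iff) linarith
      then show ?thesis
        unfolding partial_derivs_cap[OF assms(2,3)] using assms by (simp add: abs_divide divide_right_mono)
    next
      case False
      with 0 assms show ?thesis by simp
    qed
  qed
qed

definition hessian_trace :: "(real^'n \<Rightarrow> real^'n^'n) \<Rightarrow> real^'n \<Rightarrow> real" where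
  "hessian_trace H z = (\<Sum>i\<in>UNIV. H z $ i $ i)"

lemma locally_integrable_trace:
  assumes "distributional_hessian u H"
  shows "locally_integrable (hessian_trace H)"
proof -
  have "locally_integrable (\<lambda>x. H x $ i $ i)" for i
    using assms unfolding distributional_hessian_def distributional_deriv_def by blast
  then show ?thesis
    unfolding locally_integrable_def set_integrable_def hessian_trace_def scaleR_sum_right
    by (intro allI impI Bochner_Integration.integrable_sum) blast
qed

text \<open>The only place where the defining identity of the distributional Hessian is used: its diagonal
  entries move the Laplacian from the test function to \<open>u\<close>.\<close>

lemma integral_cap_laplacian:
  fixes u :: "real^'n \<Rightarrow> real"
  assumes H: "distributional_hessian u H" and kt: "0 < k" "0 < t"
  shows "(LINT z|lebesgue. u z * cap_laplacian k x t z) = (LINT z|lebesgue. hessian_trace H z * cap k x t z)"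
proof -
  have dd: "distributional_deriv [i, i] u (\<lambda>x. H x $ i $ i)" for i
    using H unfolding distributional_hessian_def by blast
  then have li: "locally_integrable u" "locally_integrable (\<lambda>x. H x $ i $ i)" for i
    unfolding distributional_deriv_def by blast+
  have "(LINT z|lebesgue. u z * cap_laplacian k x t z)
      = (LINT z|lebesgue. (\<Sum>i\<in>UNIV. u z * partial_derivs [i, i] (cap k x t) z))"
    by (simp only: sum_partial_derivs_cap[OF kt, symmetric] sum_distrib_left)
  also have "\<dots> = (\<Sum>i\<in>UNIV. LINT z|lebesgue. u z * partial_derivs [i, i] (cap k x t) z)"
    by (rule Bochner_Integration.integral_sum) (rule integrable_mult_cap_derivs(2)[OF li(1) kt])
  also have "\<dots> = (\<Sum>i\<in>UNIV. LINT z|lebesgue. H z $ i $ i * cap k x t z)"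
    using dd cap_test_function[OF kt] unfolding distributional_deriv_def by (intro sum.cong refl) fastforce
  also have "\<dots> = (LINT z|lebesgue. (\<Sum>i\<in>UNIV. H z $ i $ i * cap k x t z))"
    by (rule Bochner_Integration.integral_sum[symmetric]) (rule integrable_mult_cap_derivs(1)[OF li(2) kt])
  finally show ?thesis by (simp add: hessian_trace_def sum_distrib_right)
qed

lemma abs_hessian_trace_le: "\<bar>hessian_trace H z\<bar> \<le> CARD('n) * norm (H z)" for H :: "real^'n \<Rightarrow> real^'n^'n"
proof -
  have "\<bar>H z $ i $ i\<bar> \<le> norm (H z)" for i
    using component_le_norm_cart[of "H z $ i" i] Finite_Cartesian_Product.norm_nth_le[of "H z" i] by linarith
  then have "(\<Sum>i\<in>UNIV. \<bar>H z $ i $ i\<bar>) \<le> (\<Sum>i\<in>(UNIV::'n set). norm (H z))"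
    by (rule sum_mono)
  then show ?thesis
    unfolding hessian_trace_def by (intro order.trans[OF sum_abs]) simp
qed

text \<open>On \<open>ball x t\<close> the cap is at most \<open>1 / (2 * t ^ n)\<close>, so the integral is a multiple of the average of
  \<open>norm (H z)\<close> over that ball, with a constant independent of \<open>k\<close> and \<open>t\<close>.\<close>

lemma integral_trace_cap_bound:
  fixes u :: "real^'n \<Rightarrow> real"
  assumes H: "distributional_hessian u H" and kt: "0 < k" "0 < t"
    and m: "maximal_function H x \<le> ennreal m" "0 \<le> m"
  shows "\<bar>LINT z|lebesgue. hessian_trace H z * cap k x t z\<bar> \<le> CARD('n) * unit_ball_vol CARD('n) / 2 * m"
proof -
  let ?N = "real CARD('n)" and ?w = "unit_ball_vol CARD('n)"
  have [measurable]: "hessian_trace H \<in> borel_measurable lebesgue"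
    using locally_integrable_borel_measurable[OF locally_integrable_trace[OF H]] .
  have w: "0 \<le> ?w" by simp
  have "ennreal \<bar>LINT z|lebesgue. hessian_trace H z * cap k x t z\<bar>
      \<le> (\<integral>\<^sup>+z. ennreal \<bar>hessian_trace H z * cap k x t z\<bar> \<partial>lebesgue)"
    using integral_norm_bound_ennreal[OF integrable_mult_cap_derivs(1)[OF locally_integrable_trace[OF H] kt]] by simp
  also have "\<dots> \<le> (\<integral>\<^sup>+z. ennreal (?N / (2 * t ^ CARD('n))) *
      (ennreal (\<bar>hessian_trace H z\<bar> / ?N) * indicator (ball x t) z) \<partial>lebesgue)"
  proof (rule nn_integral_mono)
    fix z
    have "\<bar>hessian_trace H z * cap k x t z\<bar> \<le> \<bar>hessian_trace H z\<bar> * (indicator (ball x t) z / (2 * t ^ CARD('n)))"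
      unfolding abs_mult abs_of_nonneg[OF cap_bounds(1)[OF kt]] by (intro mult_left_mono cap_bounds kt) simp
    also have "\<dots> = ?N / (2 * t ^ CARD('n)) * (\<bar>hessian_trace H z\<bar> / ?N * indicator (ball x t) z)"
      by simp
    finally show "ennreal \<bar>hessian_trace H z * cap k x t z\<bar> \<le> ennreal (?N / (2 * t ^ CARD('n))) *
      (ennreal (\<bar>hessian_trace H z\<bar> / ?N) * indicator (ball x t) z)"
      using kt by (subst ennreal_indicator[symmetric], subst ennreal_mult[symmetric]) 
        (auto simp flip: ennreal_mult intro!: ennreal_leI)
  qed
  also have "\<dots> = ennreal (?N / (2 * t ^ CARD('n))) *
      (\<integral>\<^sup>+z\<in>ball x t. ennreal (\<bar>hessian_trace H z\<bar> / ?N) \<partial>lebesgue)"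
    by (rule nn_integral_cmult) (intro borel_measurable_times_ennreal borel_measurable_indicator; simp)
  also have "\<dots> \<le> ennreal (?N / (2 * t ^ CARD('n))) *
      (\<integral>\<^sup>+z\<in>ball x t. ennreal (norm (H z)) \<partial>lebesgue)"
    using abs_hessian_trace_le[of H]
    by (intro mult_left_mono nn_integral_mono mult_right_mono ennreal_leI) (auto simp: field_simps)
  also have "\<dots> \<le> ennreal (?N / (2 * t ^ CARD('n))) * (maximal_function H x * ennreal (?w * t ^ CARD('n)))"
    using kt by (intro mult_left_mono nn_integral_ball_le_maximal_function) auto
  also have "\<dots> \<le> ennreal (?N / (2 * t ^ CARD('n))) * (ennreal m * ennreal (?w * t ^ CARD('n)))"
    by (intro mult_left_mono mult_right_mono m) auto
  also have "\<dots> = ennreal (?N * ?w / 2 * m)"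
    using kt m(2) w by (simp flip: ennreal_mult)
  finally show ?thesis
    by (subst (asm) ennreal_le_iff) (intro mult_nonneg_nonneg divide_nonneg_nonneg m w; simp)
qed

text \<open>Integrate \<open>d/dt smooth_ball = t * cap_laplacian\<close> over \<open>{d..r}\<close>, exchange the \<open>t\<close> and \<open>z\<close> integrals, move
  the Laplacian to \<open>u\<close>, and estimate the remaining integrals uniformly in \<open>t\<close>. The maximal function enters only
  through its value at the centre.\<close>

lemma integral_smooth_ball_difference:
  fixes u :: "real^'n \<Rightarrow> real"
  assumes H: "distributional_hessian u H" and k: "0 < k" and dr: "0 < d" "d \<le> r"
    and m: "maximal_function H x \<le> ennreal m" "0 \<le> m"
  shows "\<bar>(LINT z|lebesgue. u z * smooth_ball k x r z) - (LINT z|lebesgue. u z * smooth_ball k x d z)\<bar>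
    \<le> CARD('n) * unit_ball_vol CARD('n) / 2 * m * r\<^sup>2"
proof -
  interpret sigma_finite_measure "lebesgue :: (real^'n) measure" by (rule sigma_finite_lebesgue)
  interpret pair_sigma_finite "lebesgue :: (real^'n) measure" "lborel :: real measure" ..
  let ?C = "CARD('n) * unit_ball_vol CARD('n) / 2 * m"
  have u: "locally_integrable u" 
    using H unfolding distributional_hessian_def distributional_deriv_def by blast
  have [measurable]: "u \<in> borel_measurable lebesgue"
    using locally_integrable_borel_measurable[OF u] .
  \<comment> \<open>The cut-off in \<open>t\<close> makes \<open>g\<close> integrable on the product space, as required by Fubini.\<close>
  define g where "g z t = u z * (indicator {d..r} t * (t * cap_laplacian k x t z))" for z t
  have g_int: "integrable (lebesgue \<Otimes>\<^sub>M lborel) (\<lambda>p. g (fst p) (snd p))"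
  proof (rule Bochner_Integration.integrable_bound)
    define B where "B = r * ((12 * k + CARD('n)) / d ^ (CARD('n) + 2))"
    have B: "0 \<le> B" using k dr by (simp add: B_def)
    show "integrable (lebesgue \<Otimes>\<^sub>M lborel) 
        (\<lambda>p. (indicator (ball x r) (fst p) *\<^sub>R u (fst p)) * (indicator {d..r} (snd p) * B))"
    proof (rule integrable_times)
      show "integrable lebesgue (\<lambda>z. indicator (ball x r) z *\<^sub>R u z)"
        using locally_integrable_ball[OF u] by (simp add: set_integrable_def)
      show "integrable lborel (\<lambda>t. indicator {d..r} t * B)"
        by (intro integrable_mult_left integrable_real_indicator) (auto simp: emeasure_lborel_Icc_eq)
    qed
    show "(\<lambda>p. g (fst p) (snd p)) \<in> borel_measurable (lebesgue \<Otimes>\<^sub>M lborel)"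
      unfolding g_def by measurable
    have "\<bar>g z t\<bar> \<le> \<bar>(indicator (ball x r) z *\<^sub>R u z) * (indicator {d..r} t * B)\<bar>" for z t
    proof (cases "t \<in> {d..r}")
      case True
      then have t: "0 < t" "d \<le> t" "t \<le> r" using dr by auto
      have "\<bar>t * cap_laplacian k x t z\<bar> \<le> r * ((12 * k + CARD('n)) / t ^ (CARD('n) + 2) * indicator (ball x t) z)"
        unfolding abs_mult using t dr by (intro mult_mono cap_laplacian_bound k) auto
      also have "\<dots> \<le> r * ((12 * k + CARD('n)) / d ^ (CARD('n) + 2) * indicator (ball x r) z)"
        using t k dr by (intro mult_left_mono mult_mono divide_left_mono power_mono) (auto simp: indicator_def)
      finally have "\<bar>u z\<bar> * \<bar>t * cap_laplacian k x t z\<bar> \<le> \<bar>u z\<bar> * (B * indicator (ball x r) z)"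
        by (intro mult_left_mono) (auto simp: B_def mult_ac)
      then show ?thesis
        using True B by (simp add: g_def abs_mult mult_ac)
    qed (simp add: g_def)
    then show "AE p in lebesgue \<Otimes>\<^sub>M lborel. norm (g (fst p) (snd p)) \<le>
        norm ((indicator (ball x r) (fst p) *\<^sub>R u (fst p)) * (indicator {d..r} (snd p) * B))"
      by simp
  qed
  have inner: "(LINT t|lborel. g z t) = u z * smooth_ball k x r z - u z * smooth_ball k x d z" for z
  proof -
    have "(LBINT t. (t * cap_laplacian k x t z) * indicator {d..r} t) = smooth_ball k x r z - smooth_ball k x d z"
    proof (rule integral_FTC_Icc_real[OF dr(2)])
      show "((\<lambda>t. smooth_ball k x t z) has_real_derivative t * cap_laplacian k x t z) (at t)"
        if "d \<le> t" "t \<le> r" for t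
        by (intro smooth_ball_has_real_derivative k) (use that dr in linarith)
      have "isCont (\<lambda>t. t * cap_laplacian k x t z) t" if "0 < t" for t
        unfolding cap_laplacian_def using that
        by (intro continuous_intros isCont_o2[OF _ DERIV_isCont[OF flat_exp_has_real_derivative]]
            isCont_o2[OF _ DERIV_isCont[OF ramp'_has_real_derivative]]) auto
      then show "isCont (\<lambda>t. t * cap_laplacian k x t z) t" if "d \<le> t" "t \<le> r" for t
        using that dr by auto
    qed
    moreover have "g z = (\<lambda>t. u z * ((t * cap_laplacian k x t z) * indicator {d..r} t))"
      by (simp add: g_def fun_eq_iff)
    ultimately show ?thesis by (simp only: integral_mult_right_zero right_diff_distrib)
  qed
  have "(LINT z|lebesgue. u z * smooth_ball k x r z) - (LINT z|lebesgue. u z * smooth_ball k x d z)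
      = (LINT z|lebesgue. LINT t|lborel. g z t)"
    unfolding inner using dr
    by (intro Bochner_Integration.integral_diff[symmetric] integrable_mult_cap_derivs(3)[OF u k]) auto
  also have "\<dots> = (LINT t|lborel. LINT z|lebesgue. g z t)"
    using Fubini_integral[of g] g_int by (simp add: case_prod_beta')
  also have "\<dots> = (LINT t|lborel. indicator {d..r} t * (t * (LINT z|lebesgue. hessian_trace H z * cap k x t z)))"
  proof (rule Bochner_Integration.integral_cong[OF refl])
    fix t
    show "(LINT z|lebesgue. g z t) = indicator {d..r} t * (t * (LINT z|lebesgue. hessian_trace H z * cap k x t z))"
    proof (cases "t \<in> {d..r}")
      case True
      then have "(LINT z|lebesgue. g z t) = (LINT z|lebesgue. t * (u z * cap_laplacian k x t z))"
        by (intro Bochner_Integration.integral_cong) (auto simp: g_def)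
      also have "\<dots> = t * (LINT z|lebesgue. hessian_trace H z * cap k x t z)"
        using True dr by (subst integral_mult_right_zero) (auto simp: integral_cap_laplacian[OF H k])
      finally show ?thesis using True by simp
    qed (simp add: g_def)
  qed
  also have "\<bar>\<dots>\<bar> \<le> (LINT t|lborel. indicator {d..r} t * (r * ?C))"
  proof (rule order.trans[OF integral_abs_bound])
    have *: "\<bar>indicator {d..r} t * (t * (LINT z|lebesgue. hessian_trace H z * cap k x t z))\<bar> \<le> indicator {d..r} t * (r * ?C)" for t
    proof (cases "t \<in> {d..r}")
      case True
      then have "\<bar>t\<bar> * \<bar>LINT z|lebesgue. hessian_trace H z * cap k x t z\<bar> \<le> r * ?C"
        using dr by (intro mult_mono integral_trace_cap_bound[OF H k _ m]) auto
      then show ?thesis using True by (simp add: abs_mult)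
    qed simp
    show "(LINT t|lborel. \<bar>indicator {d..r} t * (t * (LINT z|lebesgue. hessian_trace H z * cap k x t z))\<bar>)
        \<le> (LINT t|lborel. indicator {d..r} t * (r * ?C))"
    proof (rule integral_mono')
      show "integrable lborel (\<lambda>t. indicator {d..r} t * (r * ?C))"
        by (intro integrable_mult_left integrable_real_indicator) (auto simp: emeasure_lborel_Icc_eq)
      show "0 \<le> indicator {d..r} t * (r * ?C)" for t
        using m dr by (intro mult_nonneg_nonneg) auto
    qed (rule *)
  qed
  also have "\<dots> = (r - d) * (r * ?C)"
    using dr by simp
  also have "\<dots> \<le> r * (r * ?C)"
    using dr m by (intro mult_right_mono) auto
  finally show ?thesis by (simp add: power2_eq_square mult_ac)
qed

lemma integral_smooth_ball_tendsto:
  fixes u :: "real^'n \<Rightarrow> real"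
  assumes u: "locally_integrable u" and t: "0 < t"
  shows "(\<lambda>k. LINT z|lebesgue. u z * smooth_ball (real (Suc k)) x t z)
    \<longlonglongrightarrow> (LINT z:ball x t|lebesgue. u z) / t ^ CARD('n)"
proof -
  have [measurable]: "u \<in> borel_measurable lebesgue"
    using locally_integrable_borel_measurable[OF u] .
  have int: "integrable lebesgue (\<lambda>z. indicator (ball x t) z *\<^sub>R u z / t ^ CARD('n))"
    using locally_integrable_ball[OF u, of x t] by (simp add: set_integrable_def)
  have "(\<lambda>k. LINT z|lebesgue. u z * smooth_ball (real (Suc k)) x t z)
    \<longlonglongrightarrow> (LINT z|lebesgue. indicator (ball x t) z *\<^sub>R u z / t ^ CARD('n))"
  proof (rule integral_dominated_convergence)
    show "integrable lebesgue (\<lambda>z. \<bar>indicator (ball x t) z *\<^sub>R u z / t ^ CARD('n)\<bar>)"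
      using int by (rule integrable_abs)
    show "AE z in lebesgue. norm (u z * smooth_ball (real (Suc k)) x t z)
        \<le> \<bar>indicator (ball x t) z *\<^sub>R u z / t ^ CARD('n)\<bar>" for k
    proof (intro always_eventually allI)
      fix z
      have "0 < real (Suc k)" by simp
      note b = smooth_ball_bounds[OF this t, of x z]
      have "\<bar>u z\<bar> * smooth_ball (real (Suc k)) x t z \<le> \<bar>u z\<bar> * (indicator (ball x t) z / t ^ CARD('n))"
        by (intro mult_left_mono b) simp
      then show "norm (u z * smooth_ball (real (Suc k)) x t z) \<le> \<bar>indicator (ball x t) z *\<^sub>R u z / t ^ CARD('n)\<bar>"
        using b(1) t by (simp add: abs_mult mult_ac)
    qed
    show "AE z in lebesgue. (\<lambda>k. u z * smooth_ball (real (Suc k)) x t z)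
        \<longlonglongrightarrow> indicator (ball x t) z *\<^sub>R u z / t ^ CARD('n)"
    proof (intro always_eventually allI)
      fix z
      show "(\<lambda>k. u z * smooth_ball (real (Suc k)) x t z) \<longlonglongrightarrow> indicator (ball x t) z *\<^sub>R u z / t ^ CARD('n)"
      proof (cases "z \<in> ball x t")
        case True
        then have "norm (z - x) < t" by (simp add: dist_norm norm_minus_commute)
        then have "(norm (z - x))\<^sup>2 < t\<^sup>2" using t by (intro power_strict_mono) auto
        then have "0 < 1 - (norm (z - x))\<^sup>2 / t\<^sup>2" using t by simp
        then have "(\<lambda>k. ramp' (real (Suc k) * (1 - (norm (z - x))\<^sup>2 / t\<^sup>2))) \<longlonglongrightarrow> 1"
          by (intro LIMSEQ_Suc ramp'_tendsto)
        moreover have "real (Suc k) * (1 - (norm (z - x))\<^sup>2 / t\<^sup>2) = 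
            real (Suc k) - real (Suc k) / t\<^sup>2 * (norm (z - x))\<^sup>2" for k
          by (simp only: right_diff_distrib mult_1_right times_divide_eq_left times_divide_eq_right)
        ultimately have "(\<lambda>k. u z * smooth_ball (real (Suc k)) x t z) \<longlonglongrightarrow> u z * (1 / t ^ CARD('n))"
          unfolding smooth_ball_def using t by (intro tendsto_intros) auto
        then show ?thesis using True by simp
      next
        case False
        then have "smooth_ball (real (Suc k)) x t z = 0" for k
          using smooth_ball_bounds[of "real (Suc k)" t x z] t by simp
        then show ?thesis using False by simp
      qed
    qed
    show "(\<lambda>z. indicator (ball x t) z *\<^sub>R u z / t ^ CARD('n)) \<in> borel_measurable lebesgue"
      using borel_measurable_integrable[OF int] .
  qed measurable
  then show ?thesis by (simp add: set_lebesgue_integral_def)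
qed

text \<open>The bound for smoothed balls does not depend on \<open>k\<close>, so it survives the limit to sharp balls.\<close>

lemma ball_integral_difference:
  fixes u :: "real^'n \<Rightarrow> real"
  assumes H: "distributional_hessian u H" and dr: "0 < d" "d \<le> r"
    and m: "maximal_function H x \<le> ennreal m" "0 \<le> m"
  shows "\<bar>(LINT z:ball x r|lebesgue. u z) / r ^ CARD('n) - (LINT z:ball x d|lebesgue. u z) / d ^ CARD('n)\<bar>
    \<le> CARD('n) * unit_ball_vol CARD('n) / 2 * m * r\<^sup>2"
proof -
  have u: "locally_integrable u" 
    using H unfolding distributional_hessian_def distributional_deriv_def by blast
  show ?thesis
  proof (rule LIMSEQ_le_const2)
    show "(\<lambda>k. \<bar>(LINT z|lebesgue. u z * smooth_ball (real (Suc k)) x r z) -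
          (LINT z|lebesgue. u z * smooth_ball (real (Suc k)) x d z)\<bar>)
      \<longlonglongrightarrow> \<bar>(LINT z:ball x r|lebesgue. u z) / r ^ CARD('n) - (LINT z:ball x d|lebesgue. u z) / d ^ CARD('n)\<bar>"
      using dr by (intro tendsto_intros integral_smooth_ball_tendsto[OF u]) auto
  qed (use integral_smooth_ball_difference[OF H _ dr m] in auto)
qed

section \<open>Recovering a function from its ball averages\<close>

lemma tendsto_0_ennreal_le:
  fixes f g :: "'a \<Rightarrow> ennreal"
  assumes "(g \<longlongrightarrow> 0) F" "\<And>y. f y \<le> g y"
  shows "(f \<longlongrightarrow> 0) F"
  by (rule tendsto_sandwich[OF _ _ tendsto_const assms(1)]) (use assms(2) in simp_all)

lemma nn_integral_lborel_translate:
  fixes a :: "'a::euclidean_space"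
  assumes "f \<in> borel_measurable borel"
  shows "(\<integral>\<^sup>+x. f (a + x) \<partial>lborel) = (\<integral>\<^sup>+x. f x \<partial>lborel)"
proof -
  have "(\<integral>\<^sup>+x. f x \<partial>lborel) = (\<integral>\<^sup>+x. f x \<partial>distr lborel borel ((+) a))"
    by (simp only: lborel_distr_plus)
  also have "\<dots> = (\<integral>\<^sup>+x. f (a + x) \<partial>lborel)"
    using assms by (intro nn_integral_distr) auto
  finally show ?thesis by simp
qed

definition shift_dist :: "('a::euclidean_space \<Rightarrow> real) \<Rightarrow> 'a \<Rightarrow> ennreal" where
  "shift_dist f y = (\<integral>\<^sup>+x. ennreal \<bar>f (y + x) - f x\<bar> \<partial>lborel)"

lemma shift_dist_le:
  assumes [measurable]: "f \<in> borel_measurable borel" "g \<in> borel_measurable borel"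
  shows "shift_dist f y \<le> 2 * (\<integral>\<^sup>+x. ennreal \<bar>f x - g x\<bar> \<partial>lborel) + shift_dist g y"
proof -
  have "shift_dist f y \<le> (\<integral>\<^sup>+x. (ennreal \<bar>f (y + x) - g (y + x)\<bar> + ennreal \<bar>f x - g x\<bar>) + ennreal \<bar>g (y + x) - g x\<bar> \<partial>lborel)"
    unfolding shift_dist_def
    by (intro nn_integral_mono) (simp flip: ennreal_plus)
  also have "\<dots> = ((\<integral>\<^sup>+x. ennreal \<bar>f (y + x) - g (y + x)\<bar> \<partial>lborel) + (\<integral>\<^sup>+x. ennreal \<bar>f x - g x\<bar> \<partial>lborel)) + shift_dist g y"
    unfolding shift_dist_def by (subst nn_integral_add; simp)+
  also have "(\<integral>\<^sup>+x. ennreal \<bar>f (y + x) - g (y + x)\<bar> \<partial>lborel) = (\<integral>\<^sup>+x. ennreal \<bar>f x - g x\<bar> \<partial>lborel)"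
    by (rule nn_integral_lborel_translate[of "\<lambda>x. ennreal \<bar>f x - g x\<bar>"]) simp
  finally show ?thesis by (simp add: mult_2)
qed

text \<open>Continuity of translations in \<open>L\<^sup>1\<close> is stable under \<open>L\<^sup>1\<close> limits.\<close>

lemma shift_dist_approx:
  assumes [measurable]: "f \<in> borel_measurable borel"
    and approx: "\<And>e. 0 < e \<Longrightarrow> \<exists>g\<in>borel_measurable borel.
      (\<integral>\<^sup>+x. ennreal \<bar>f x - g x\<bar> \<partial>lborel) \<le> ennreal e \<and> (shift_dist g \<longlongrightarrow> 0) (at 0)"
  shows "(shift_dist f \<longlongrightarrow> 0) (at 0)"
proof (rule tendsto_zero_ennreal)
  fix e :: real assume e: "0 < e"
  then obtain g where g: "g \<in> borel_measurable borel" "(\<integral>\<^sup>+x. ennreal \<bar>f x - g x\<bar> \<partial>lborel) \<le> ennreal (e / 4)"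
    "(shift_dist g \<longlongrightarrow> 0) (at 0)"
    using approx[of "e/4"] by auto
  have "\<forall>\<^sub>F y in at 0. shift_dist g y < ennreal (e / 2)"
    using order_tendstoD(2)[OF g(3), of "ennreal (e/2)"] e by simp
  then show "\<forall>\<^sub>F y in at 0. shift_dist f y < ennreal e"
  proof eventually_elim
    case (elim y)
    have "shift_dist f y \<le> 2 * ennreal (e / 4) + shift_dist g y"
      using g(2) by (intro order.trans[OF shift_dist_le[OF assms(1) g(1)]] add_right_mono mult_left_mono) auto
    also have "\<dots> < 2 * ennreal (e / 4) + ennreal (e / 2)"
      using elim e by (intro ennreal_add_left_cancel_less[THEN iffD2]) (auto simp: ennreal_mult_eq_top_iff)
    also have "2 * ennreal (e / 4) = ennreal (e / 2)"
      using e by (subst ennreal_numeral[symmetric], subst ennreal_mult[symmetric]) auto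
    finally show ?case using e by (simp flip: ennreal_plus)
  qed
qed

text \<open>A point of \<open>U\<close> stays in \<open>U\<close> under all small
  translations, so the mass that leaves \<open>U\<close> tends to \<open>0\<close> by dominated convergence, and the mass that
  enters \<open>U\<close> is the mass that leaves it under the opposite translation.\<close>

lemma shift_dist_open:
  fixes U :: "'a::euclidean_space set"
  assumes U: "open U" "emeasure lborel U < \<infinity>"
  shows "(shift_dist (\<lambda>x. indicator U x * c) \<longlongrightarrow> 0) (at 0)"
proof -
  have [measurable]: "U \<in> sets borel" using U by simp
  have loss: "(\<lambda>k. \<integral>\<^sup>+x. indicator U x * indicator (- U) (X k + x) \<partial>lborel) \<longlonglongrightarrow> (0::ennreal)"
    if X: "X \<longlonglongrightarrow> 0" for X
  proof -
    have "(\<lambda>k. \<integral>\<^sup>+x. indicator U x * indicator (- U) (X k + x) \<partial>lborel) \<longlonglongrightarrow> (\<integral>\<^sup>+x. (0::ennreal) \<partial>(lborel::'a measure))"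
    proof (rule nn_integral_dominated_convergence[where w="indicator U"])
      show "AE x in lborel. (\<lambda>k. indicator U x * indicator (- U) (X k + x)) \<longlonglongrightarrow> (0::ennreal)"
      proof (intro always_eventually allI)
        fix x
        show "(\<lambda>k. indicator U x * indicator (- U) (X k + x)) \<longlonglongrightarrow> (0::ennreal)"
        proof (cases "x \<in> U")
          case True
          have "(\<lambda>k. X k + x) \<longlonglongrightarrow> 0 + x" by (intro tendsto_intros X)
          then have "\<forall>\<^sub>F k in sequentially. X k + x \<in> U"
            using True U by (auto dest: topological_tendstoD)
          then have "\<forall>\<^sub>F k in sequentially. indicator U x * indicator (- U) (X k + x) = (0::ennreal)"
            by (rule eventually_mono) simp
          then show ?thesis by (rule tendsto_eventually)
        qed simp
      qed
      show "(\<integral>\<^sup>+x. indicator U x \<partial>lborel) < \<infinity>" using U by simp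
      show "AE x in lborel. indicator U x * indicator (- U) (X k + x) \<le> (indicator U x :: ennreal)" for k
        by (intro always_eventually allI) (simp split: split_indicator)
    qed measurable
    then show ?thesis by simp
  qed
  have bd: "shift_dist (\<lambda>x. indicator U x * c) y \<le> ennreal \<bar>c\<bar> *
      ((\<integral>\<^sup>+x. indicator U x * indicator (- U) (y + x) \<partial>lborel) + (\<integral>\<^sup>+x. indicator U x * indicator (- U) (- y + x) \<partial>lborel))" for y
  proof -
    have "shift_dist (\<lambda>x. indicator U x * c) y \<le>
      (\<integral>\<^sup>+x. ennreal \<bar>c\<bar> * (indicator U x * indicator (- U) (y + x) + indicator U (y + x) * indicator (- U) (- y + (y + x))) \<partial>lborel)"
      unfolding shift_dist_def by (intro nn_integral_mono) (simp split: split_indicator)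
    also have "\<dots> = ennreal \<bar>c\<bar> * ((\<integral>\<^sup>+x. indicator U x * indicator (- U) (y + x) \<partial>lborel) + 
        (\<integral>\<^sup>+x. indicator U (y + x) * indicator (- U) (- y + (y + x)) \<partial>lborel))"
      by (simp add: nn_integral_cmult nn_integral_add)
    also have "(\<integral>\<^sup>+x. indicator U (y + x) * indicator (- U) (- y + (y + x)) \<partial>lborel) = 
        (\<integral>\<^sup>+x. indicator U x * indicator (- U) (- y + x) \<partial>lborel)"
      by (rule nn_integral_lborel_translate[of "\<lambda>x. indicator U x * indicator (- U) (- y + x)"]) measurable
    finally show ?thesis .
  qed
  show ?thesis
    unfolding tendsto_at_iff_sequentially
  proof (intro allI impI)
    fix X :: "nat \<Rightarrow> 'a" assume X: "X \<longlonglongrightarrow> 0"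
    then have X': "(\<lambda>k. - X k) \<longlonglongrightarrow> 0" using tendsto_minus by fastforce
    have "(\<lambda>k. ennreal \<bar>c\<bar> * ((\<integral>\<^sup>+x. indicator U x * indicator (- U) (X k + x) \<partial>lborel) + 
        (\<integral>\<^sup>+x. indicator U x * indicator (- U) (- X k + x) \<partial>lborel))) \<longlonglongrightarrow> ennreal \<bar>c\<bar> * (0 + 0)"
      by (intro ennreal_tendsto_cmult tendsto_add loss X X') auto
    then show "(shift_dist (\<lambda>x. indicator U x * c) \<circ> X) \<longlonglongrightarrow> 0"
      unfolding comp_def add_0 mult_zero_right by (rule tendsto_0_ennreal_le) (rule bd)
  qed
qed

text \<open>From open sets to Borel sets by outer regularity, then to integrable functions by the usual
  induction.\<close>

lemma shift_dist_tendsto: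
  fixes f :: "'a::euclidean_space \<Rightarrow> real"
  assumes "integrable lborel f"
  shows "(shift_dist f \<longlongrightarrow> 0) (at 0)"
  using assms
proof (induction rule: integrable_induct)
  case (base A c)
  then have [measurable]: "A \<in> sets borel" by simp
  show ?case
  proof (rule shift_dist_approx)
    fix e :: real assume e: "0 < e"
    then obtain U where U: "open U" "A \<subseteq> U" "emeasure lborel (U - A) < ennreal (e / (\<bar>c\<bar> + 1))"
      using outer_regular_lborel[of A "e / (\<bar>c\<bar> + 1)"] by (auto simp: add_nonneg_pos)
    have [measurable]: "U \<in> sets borel" using U by simp
    have "emeasure lborel U \<le> emeasure lborel A + emeasure lborel (U - A)"
      using U by (subst plus_emeasure) (auto simp: Un_absorb1)
    also have "\<dots> < \<infinity>" using base U(3) by (auto simp: less_top[symmetric] intro: order.strict_trans)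
    finally have fin: "emeasure lborel U < \<infinity>" .
    have "(\<integral>\<^sup>+x. ennreal \<bar>indicator A x *\<^sub>R c - indicator U x * c\<bar> \<partial>lborel) = (\<integral>\<^sup>+x. ennreal \<bar>c\<bar> * indicator (U - A) x \<partial>lborel)"
      using U(2) by (intro nn_integral_cong) (auto simp: indicator_def)
    also have "\<dots> = ennreal \<bar>c\<bar> * emeasure lborel (U - A)"
      by (simp add: nn_integral_cmult_indicator)
    also have "\<dots> \<le> ennreal \<bar>c\<bar> * ennreal (e / (\<bar>c\<bar> + 1))"
      using U(3) by (intro mult_left_mono) auto
    also have "\<dots> \<le> ennreal e"
      using e by (auto simp flip: ennreal_mult intro!: ennreal_leI simp: field_simps)
    finally show "\<exists>g\<in>borel_measurable borel. (\<integral>\<^sup>+x. ennreal \<bar>indicator A x *\<^sub>R c - g x\<bar> \<partial>lborel) \<le> ennreal e \<and>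
        (shift_dist g \<longlongrightarrow> 0) (at 0)"
      using shift_dist_open[OF U(1) fin, of c] by (intro bexI[of _ "\<lambda>x. indicator U x * c"]) auto
  qed simp
next
  case (add f g)
  then have [measurable]: "f \<in> borel_measurable borel" "g \<in> borel_measurable borel" by auto
  have "shift_dist (\<lambda>x. f x + g x) y \<le> shift_dist f y + shift_dist g y" for y
  proof -
    have "shift_dist (\<lambda>x. f x + g x) y \<le> (\<integral>\<^sup>+x. ennreal \<bar>f (y + x) - f x\<bar> + ennreal \<bar>g (y + x) - g x\<bar> \<partial>lborel)"
      unfolding shift_dist_def
    proof (rule nn_integral_mono)
      fix x
      have "\<bar>f (y + x) + g (y + x) - (f x + g x)\<bar> \<le> \<bar>f (y + x) - f x\<bar> + \<bar>g (y + x) - g x\<bar>"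
        by linarith
      then show "ennreal \<bar>f (y + x) + g (y + x) - (f x + g x)\<bar>
          \<le> ennreal \<bar>f (y + x) - f x\<bar> + ennreal \<bar>g (y + x) - g x\<bar>"
        using ennreal_leI by (simp only: ennreal_plus[symmetric] abs_ge_zero)
    qed
    also have "\<dots> = shift_dist f y + shift_dist g y"
      unfolding shift_dist_def by (rule nn_integral_add) auto
    finally show ?thesis .
  qed
  note le = this
  have "((\<lambda>y. shift_dist f y + shift_dist g y) \<longlongrightarrow> 0 + 0) (at 0)"
    by (intro tendsto_add add.IH)
  then show ?case
    unfolding add_0 by (rule tendsto_0_ennreal_le) (rule le)
next
  case (lim f s)
  then have [measurable]: "f \<in> borel_measurable borel" "\<And>i. s i \<in> borel_measurable borel" by auto
  have f: "integrable lborel (\<lambda>x. 3 * \<bar>f x\<bar>)" using lim by auto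
  have "(\<lambda>i. \<integral>\<^sup>+x. ennreal \<bar>f x - s i x\<bar> \<partial>lborel) \<longlonglongrightarrow> (\<integral>\<^sup>+x. 0 \<partial>(lborel :: 'a measure))"
  proof (rule nn_integral_dominated_convergence[where w="\<lambda>x. ennreal (3 * \<bar>f x\<bar>)"])
    show "(\<integral>\<^sup>+x. ennreal (3 * \<bar>f x\<bar>) \<partial>lborel) < \<infinity>"
      using f unfolding integrable_iff_bounded by auto
    have "\<bar>f x - s i x\<bar> \<le> 3 * \<bar>f x\<bar>" for i x
      using lim(3)[of x i] by (auto simp: abs_le_iff)
    then show "AE x in lborel. ennreal \<bar>f x - s i x\<bar> \<le> ennreal (3 * \<bar>f x\<bar>)" for i
      by (intro always_eventually allI ennreal_leI)
    have "(\<lambda>i. ennreal \<bar>f x - s i x\<bar>) \<longlonglongrightarrow> ennreal \<bar>f x - f x\<bar>" for x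
      using lim(2)[of x] by (intro tendsto_intros) auto
    then show "AE x in lborel. (\<lambda>i. ennreal \<bar>f x - s i x\<bar>) \<longlonglongrightarrow> 0" by simp
  qed auto
  then have L: "(\<lambda>i. \<integral>\<^sup>+x. ennreal \<bar>f x - s i x\<bar> \<partial>lborel) \<longlonglongrightarrow> 0" by simp
  show ?case
  proof (rule shift_dist_approx)
    fix e :: real assume "0 < e"
    then have "\<forall>\<^sub>F i in sequentially. (\<integral>\<^sup>+x. ennreal \<bar>f x - s i x\<bar> \<partial>lborel) < ennreal e"
      using order_tendstoD(2)[OF L, of "ennreal e"] by simp
    then obtain i where "(\<integral>\<^sup>+x. ennreal \<bar>f x - s i x\<bar> \<partial>lborel) < ennreal e"
      using eventually_happens by force
    then show "\<exists>g\<in>borel_measurable borel. (\<integral>\<^sup>+x. ennreal \<bar>f x - g x\<bar> \<partial>lborel) \<le> ennreal e \<and> (shift_dist g \<longlongrightarrow> 0) (at 0)"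
      using lim.IH[of i] by (intro bexI[of _ "s i"]) auto
  qed simp
qed

lemma shift_dist_le_norm:
  assumes [measurable]: "f \<in> borel_measurable borel"
  shows "shift_dist f y \<le> 2 * (\<integral>\<^sup>+x. ennreal \<bar>f x\<bar> \<partial>lborel)"
  using shift_dist_le[of f "\<lambda>_. 0" y] by (simp add: shift_dist_def)

text \<open>The \<open>L\<^sup>1\<close> distance between \<open>f\<close> and its averages over balls of radius \<open>d\<close> is at most the supremum of
  \<open>shift_dist f y\<close> over \<open>norm y < d\<close>, by Tonelli. Convergence in \<open>L\<^sup>1\<close> then gives convergence almost
  everywhere along a subsequence.\<close>

lemma integrable_ball_average_subseq:
  fixes f :: "'a::euclidean_space \<Rightarrow> real"
  assumes f: "integrable lborel f"
  shows "\<exists>d. (\<forall>k. 0 < d k) \<and> d \<longlonglongrightarrow> 0 \<and>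
    (AE x in lborel. (\<lambda>k. (LINT z:ball x (d k)|lborel. f z) / measure lborel (ball x (d k))) \<longlonglongrightarrow> f x)"
proof -
  have [measurable]: "f \<in> borel_measurable borel" using f by auto
  define B where "B k = ball (0::'a) (inverse (real (Suc k)))" for k
  have [measurable]: "B k \<in> sets borel" for k by (simp add: B_def)
  have B_fin: "emeasure lborel (B k) < \<infinity>" for k unfolding B_def by (rule emeasure_lborel_ball_finite)
  define V where "V k = measure lborel (B k)" for k
  have V: "0 < V k" "measure lborel (ball x (inverse (real (Suc k)))) = V k" for k and x :: 'a
    by (simp_all add: V_def B_def content_ball)
  define w where "w k x = (LINT y|lborel. indicator (B k) y *\<^sub>R (f (y + x) - f x)) / V k" for k x
  have [measurable]: "w k \<in> borel_measurable lborel" for k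
    unfolding w_def by measurable
  have trans: "integrable lborel (\<lambda>y. f (y + x))" for x
  proof -
    have "integrable (distr lborel borel ((+) x)) f" using f by (simp only: lborel_distr_plus)
    then show "integrable lborel (\<lambda>y. f (y + x))"
      by (subst (asm) integrable_distr_eq) (simp_all add: add.commute)
  qed
  have trans_eq: "(LINT y|lborel. g (y + x)) = (LINT y|lborel. g y)" if "g \<in> borel_measurable borel"
    for x and g :: "'a \<Rightarrow> real"
  proof -
    have "(LINT y|lborel. g y) = (LINT y|distr lborel borel ((+) x). g y)"
      by (simp only: lborel_distr_plus)
    also have "\<dots> = (LINT y|lborel. g (x + y))"
      using that by (intro integral_distr) auto
    finally show "(LINT y|lborel. g (y + x)) = (LINT y|lborel. g y)" by (simp add: add.commute)
  qed
  have int: "integrable lborel (\<lambda>y. indicator (B k) y *\<^sub>R f (y + x))" "integrable lborel (\<lambda>y. indicator (B k) y *\<^sub>R f x)" for k x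
    using B_fin[of k] trans[of x]
    by (intro integrable_mult_indicator integrable_scaleR_left integrable_real_indicator; simp)+
  have w_eq: "w k x = (LINT z:ball x (inverse (real (Suc k)))|lborel. f z) / measure lborel (ball x (inverse (real (Suc k)))) - f x" for k x
  proof -
    have "(LINT y|lborel. indicator (B k) y *\<^sub>R (f (y + x) - f x))
       = (LINT y|lborel. indicator (B k) y *\<^sub>R f (y + x)) - (LINT y|lborel. indicator (B k) y *\<^sub>R f x)"
      unfolding scaleR_diff_right by (rule Bochner_Integration.integral_diff[OF int])
    also have "(LINT y|lborel. indicator (B k) y *\<^sub>R f x) = V k * f x"
      by (simp add: V_def)
    also have "(LINT y|lborel. indicator (B k) y *\<^sub>R f (y + x)) = 
        (LINT y|lborel. indicator (ball x (inverse (real (Suc k)))) (y + x) *\<^sub>R f (y + x))"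
      by (intro Bochner_Integration.integral_cong refl) (auto simp: indicator_def dist_norm B_def)
    also have "\<dots> = (LINT z:ball x (inverse (real (Suc k)))|lborel. f z)"
      unfolding set_lebesgue_integral_def
      by (rule trans_eq[of "\<lambda>z. indicator (ball x (inverse (real (Suc k)))) z *\<^sub>R f z"])
        (intro borel_measurable_scaleR borel_measurable_indicator; simp)
    finally show ?thesis
      using V(1)[of k] unfolding w_def V(2) by (simp only: diff_divide_distrib) simp
  qed
  have bound: "(\<integral>\<^sup>+x. ennreal \<bar>w k x\<bar> \<partial>lborel) \<le> ennreal c"
    if "\<And>y. y \<in> B k \<Longrightarrow> shift_dist f y \<le> ennreal c" "0 \<le> c" for k c
  proof -
    have "(\<integral>\<^sup>+x. ennreal \<bar>w k x\<bar> \<partial>lborel) \<le> 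
      (\<integral>\<^sup>+x. ennreal (1 / V k) * (\<integral>\<^sup>+y. indicator (B k) y * ennreal \<bar>f (y + x) - f x\<bar> \<partial>lborel) \<partial>lborel)"
    proof (rule nn_integral_mono)
      fix x
      have "ennreal \<bar>w k x\<bar> = ennreal (1 / V k) * ennreal \<bar>LINT y|lborel. indicator (B k) y *\<^sub>R (f (y + x) - f x)\<bar>"
        using V(1)[of k] by (subst ennreal_mult[symmetric]) (auto simp: w_def abs_divide)
      also have "\<dots> \<le> ennreal (1 / V k) * (\<integral>\<^sup>+y. ennreal \<bar>indicator (B k) y *\<^sub>R (f (y + x) - f x)\<bar> \<partial>lborel)"
        using integral_norm_bound_ennreal[OF Bochner_Integration.integrable_diff[OF int(1) int(2)], of k x]
        by (intro mult_left_mono) (simp_all add: right_diff_distrib)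
      also have "(\<integral>\<^sup>+y. ennreal \<bar>indicator (B k) y *\<^sub>R (f (y + x) - f x)\<bar> \<partial>lborel) = (\<integral>\<^sup>+y. indicator (B k) y * ennreal \<bar>f (y + x) - f x\<bar> \<partial>lborel)"
        by (intro nn_integral_cong) (auto simp: indicator_def)
      finally show "ennreal \<bar>w k x\<bar> \<le> ennreal (1 / V k) * (\<integral>\<^sup>+y. indicator (B k) y * ennreal \<bar>f (y + x) - f x\<bar> \<partial>lborel)" .
    qed
    also have "\<dots> = ennreal (1 / V k) * (\<integral>\<^sup>+x. (\<integral>\<^sup>+y. indicator (B k) y * ennreal \<bar>f (y + x) - f x\<bar> \<partial>lborel) \<partial>lborel)"
      by (rule nn_integral_cmult) measurable
    finally have 1: "(\<integral>\<^sup>+x. ennreal \<bar>w k x\<bar> \<partial>lborel) \<le> ennreal (1 / V k) *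
      (\<integral>\<^sup>+x. (\<integral>\<^sup>+y. indicator (B k) y * ennreal \<bar>f (y + x) - f x\<bar> \<partial>lborel) \<partial>lborel)" .
    have "(\<integral>\<^sup>+x. (\<integral>\<^sup>+y. indicator (B k) y * ennreal \<bar>f (y + x) - f x\<bar> \<partial>lborel) \<partial>lborel) = 
        (\<integral>\<^sup>+y. (\<integral>\<^sup>+x. indicator (B k) y * ennreal \<bar>f (y + x) - f x\<bar> \<partial>lborel) \<partial>lborel)"
      by (rule lborel_pair.Fubini') measurable
    also have "\<dots> = (\<integral>\<^sup>+y. indicator (B k) y * shift_dist f y \<partial>lborel)"
      unfolding shift_dist_def by (intro nn_integral_cong nn_integral_cmult) measurable
    also have "\<dots> \<le> (\<integral>\<^sup>+y. ennreal c * indicator (B k) y \<partial>lborel)"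
      using that by (intro nn_integral_mono) (auto simp: indicator_def)
    also have "\<dots> = ennreal c * ennreal (V k)"
      by (use B_fin[of k] in \<open>simp add: nn_integral_cmult_indicator V_def emeasure_eq_ennreal_measure less_top[symmetric]\<close>)
    finally have "ennreal (1 / V k) *
        (\<integral>\<^sup>+x. (\<integral>\<^sup>+y. indicator (B k) y * ennreal \<bar>f (y + x) - f x\<bar> \<partial>lborel) \<partial>lborel)
        \<le> ennreal (1 / V k) * (ennreal c * ennreal (V k))"
      by (intro mult_left_mono) auto
    also have "\<dots> = ennreal c"
      using V(1)[of k] that(2) by (simp flip: ennreal_mult)
    finally show ?thesis using 1 by (rule order.trans[rotated])
  qed
  have f_fin: "(\<integral>\<^sup>+x. ennreal \<bar>f x\<bar> \<partial>lborel) = ennreal (LINT x|lborel. \<bar>f x\<bar>)"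
    using f by (intro nn_integral_eq_integral) auto
  have w_int: "integrable lborel (w k)" for k
  proof (rule integrableI_bounded)
    have "(\<integral>\<^sup>+x. ennreal \<bar>w k x\<bar> \<partial>lborel) \<le> ennreal (2 * (LINT x|lborel. \<bar>f x\<bar>))"
      using shift_dist_le_norm[of f] f_fin by (intro bound) (simp_all add: ennreal_mult)
    then show "(\<integral>\<^sup>+x. ennreal (norm (w k x)) \<partial>lborel) < \<infinity>"
      by (auto intro: order.strict_trans1)
  qed measurable
  have "(\<lambda>k. LINT x|lborel. norm (w k x)) \<longlonglongrightarrow> 0"
  proof (rule LIMSEQ_I)
    fix e :: real assume e: "0 < e"
    then have "\<forall>\<^sub>F y in at 0. shift_dist f y < ennreal (e / 2)"
      using order_tendstoD(2)[OF shift_dist_tendsto[OF f], of "ennreal (e/2)"] by simp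
    then obtain d where d: "0 < d" "\<And>y. y \<noteq> 0 \<Longrightarrow> norm y < d \<Longrightarrow> shift_dist f y < ennreal (e / 2)"
      unfolding eventually_at by (auto simp: dist_norm)
    obtain K where K: "inverse (real (Suc K)) < d" using reals_Archimedean[OF d(1)] by blast
    have "norm ((LINT x|lborel. norm (w k x)) - 0) < e" if "k \<ge> K" for k
    proof -
      have "inverse (real (Suc k)) \<le> inverse (real (Suc K))"
        using that by (intro le_imp_inverse_le) auto
      with K have k: "inverse (real (Suc k)) < d" by linarith
      have "shift_dist f y \<le> ennreal (e / 2)" if "y \<in> B k" for y
        using d(2)[of y] that k by (cases "y = 0") (auto simp: shift_dist_def dist_norm B_def)
      then have "(\<integral>\<^sup>+x. ennreal \<bar>w k x\<bar> \<partial>lborel) \<le> ennreal (e / 2)"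
        using e by (intro bound) auto
      moreover have "(\<integral>\<^sup>+x. ennreal \<bar>w k x\<bar> \<partial>lborel) = ennreal (LINT x|lborel. \<bar>w k x\<bar>)"
        using w_int by (intro nn_integral_eq_integral) auto
      ultimately have "(LINT x|lborel. \<bar>w k x\<bar>) \<le> e / 2"
        using e by (simp add: ennreal_le_iff)
      then show ?thesis using e by simp
    qed
    then show "\<exists>K. \<forall>k\<ge>K. norm ((LINT x|lborel. norm (w k x)) - 0) < e" by blast
  qed
  then obtain r where r: "strict_mono r" "AE x in lborel. (\<lambda>n. w (r n) x) \<longlonglongrightarrow> 0"
    using tendsto_L1_AE_subseq[of lborel w, OF w_int] by blast
  define d where "d k = inverse (real (Suc (r k)))" for k
  have "d \<longlonglongrightarrow> 0"
    unfolding d_def using LIMSEQ_subseq_LIMSEQ[OF LIMSEQ_inverse_real_of_nat r(1)] by (simp add: comp_def)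
  moreover have "AE x in lborel. (\<lambda>k. (LINT z:ball x (d k)|lborel. f z) / measure lborel (ball x (d k))) \<longlonglongrightarrow> f x"
    using r(2)
  proof eventually_elim
    case (elim x)
    then have "(\<lambda>k. w (r k) x + f x) \<longlonglongrightarrow> 0 + f x" by (intro tendsto_intros)
    then show ?case by (simp add: w_eq d_def)
  qed
  ultimately show ?thesis by (intro exI[of _ d]) (auto simp: d_def)
qed

text \<open>Near a point of \<open>ball 0 R\<close> only the restriction of \<open>u\<close> to that ball matters. The radii may depend on the
  point, through the choice of \<open>R\<close>.\<close>

lemma locally_integrable_ball_average_subseq:
  fixes u :: "real^'n \<Rightarrow> real"
  assumes u: "locally_integrable u"
  shows "AE x in lebesgue. \<exists>d. (\<forall>k. 0 < d k) \<and> d \<longlonglongrightarrow> 0 \<and>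
    (\<lambda>k. (LINT z:ball x (d k)|lebesgue. u z) / measure lebesgue (ball x (d k))) \<longlonglongrightarrow> u x"
proof -
  have "AE x in lebesgue. norm x < real R \<longrightarrow> (\<exists>d. (\<forall>k. 0 < d k) \<and> d \<longlonglongrightarrow> 0 \<and>
    (\<lambda>k. (LINT z:ball x (d k)|lebesgue. u z) / measure lebesgue (ball x (d k))) \<longlonglongrightarrow> u x)" for R :: nat
  proof -
    let ?v = "\<lambda>z. indicator (ball 0 (real R)) z *\<^sub>R u z"
    have v: "integrable lebesgue ?v"
      using locally_integrable_ball[OF u] unfolding set_integrable_def .
    then obtain f where f: "f \<in> borel_measurable lborel" "AE x in lborel. ?v x = f x"
      using completion_ex_borel_measurable_real[OF borel_measurable_integrable[OF v]] by auto
    have f_leb: "AE x in lebesgue. ?v x = f x"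
      using f(2) by (rule AE_completion)
    have "integrable lebesgue f"
      using v f_leb f(1) by (subst integrable_cong_AE[symmetric]) (auto intro: measurable_completion)
    then have "integrable lborel f"
      using f(1) by (simp add: integrable_completion)
    then obtain d where d: "\<And>k. 0 < d k" "d \<longlonglongrightarrow> 0"
      and lim: "AE x in lborel. (\<lambda>k. (LINT z:ball x (d k)|lborel. f z) / measure lborel (ball x (d k))) \<longlonglongrightarrow> f x"
      using integrable_ball_average_subseq by blast
    have "AE x in lebesgue. (\<lambda>k. (LINT z:ball x (d k)|lborel. f z) / measure lborel (ball x (d k))) \<longlonglongrightarrow> f x"
      using lim by (rule AE_completion)
    then show ?thesis
      using f_leb
    proof eventually_elim
      case (elim x)
      show ?case
      proof
        assume x: "norm x < real R"
        then have "\<forall>\<^sub>F k in sequentially. d k < real R - norm x"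
          by (intro order_tendstoD(2)[OF d(2)]) simp
        then obtain K where K: "\<And>k. k \<ge> K \<Longrightarrow> d k < real R - norm x"
          unfolding eventually_sequentially by blast
        define e where "e k = d (k + K)" for k
        have eq: "(LINT z:ball x (e k)|lborel. f z) = (LINT z:ball x (e k)|lebesgue. u z)" for k
        proof -
          have "z \<in> ball 0 (real R)" if "z \<in> ball x (e k)" for z
            using that K[of "k + K"] norm_triangle_ineq[of x "z - x"] by (simp add: e_def dist_norm norm_minus_commute)
          then have sub: "indicator (ball x (e k)) z *\<^sub>R u z = indicator (ball x (e k)) z *\<^sub>R ?v z" for z
            by (auto simp: indicator_def)
          have "(LINT z:ball x (e k)|lborel. f z) = (LINT z:ball x (e k)|lebesgue. f z)"
            unfolding set_lebesgue_integral_def 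
            by (intro integral_completion[symmetric] borel_measurable_scaleR borel_measurable_indicator f(1)) simp
          also have "\<dots> = (LINT z|lebesgue. indicator (ball x (e k)) z *\<^sub>R ?v z)"
            unfolding set_lebesgue_integral_def
          proof (rule integral_cong_AE)
            show "(\<lambda>z. indicator (ball x (e k)) z *\<^sub>R f z) \<in> borel_measurable lebesgue"
              by (intro measurable_completion borel_measurable_scaleR borel_measurable_indicator f(1)) simp
            show "(\<lambda>z. indicator (ball x (e k)) z *\<^sub>R ?v z) \<in> borel_measurable lebesgue"
              by (rule borel_measurable_scaleR[OF borel_measurable_indicator borel_measurable_integrable[OF v]]) simp
            show "AE z in lebesgue. indicator (ball x (e k)) z *\<^sub>R f z = indicator (ball x (e k)) z *\<^sub>R ?v z"
              using f_leb by eventually_elim simp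
          qed
          finally show ?thesis unfolding set_lebesgue_integral_def sub .
        qed
        have "(\<lambda>k. (LINT z:ball x (e k)|lborel. f z) / measure lborel (ball x (e k))) \<longlonglongrightarrow> f x"
          unfolding e_def using elim(1) by (rule LIMSEQ_ignore_initial_segment)
        then have "(\<lambda>k. (LINT z:ball x (e k)|lebesgue. u z) / measure lebesgue (ball x (e k))) \<longlonglongrightarrow> u x"
          unfolding eq using elim(2) x by simp
        moreover have "\<forall>k. 0 < e k" using d(1) by (simp add: e_def)
        moreover have "e \<longlonglongrightarrow> 0"
          unfolding e_def using d(2) by (rule LIMSEQ_ignore_initial_segment)
        ultimately show "\<exists>d. (\<forall>k. 0 < d k) \<and> d \<longlonglongrightarrow> 0 \<and>
            (\<lambda>k. (LINT z:ball x (d k)|lebesgue. u z) / measure lebesgue (ball x (d k))) \<longlonglongrightarrow> u x"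
          by blast
      qed
    qed
  qed
  then have "AE x in lebesgue. \<forall>R::nat. norm x < real R \<longrightarrow> (\<exists>d. (\<forall>k. 0 < d k) \<and> d \<longlonglongrightarrow> 0 \<and>
    (\<lambda>k. (LINT z:ball x (d k)|lebesgue. u z) / measure lebesgue (ball x (d k))) \<longlonglongrightarrow> u x)"
    unfolding AE_all_countable by blast
  then show ?thesis
    by eventually_elim (meson reals_Archimedean2)
qed

section \<open>Growth of ball integrals under a Muckenhoupt weight\<close>

text \<open>With \<open>w = b * v\<close> this reads \<open>a \<le> w * a powr p + w powr (- 1 / (p - 1))\<close>: if \<open>a\<close> exceeds the second
  term, then \<open>w * a powr (p - 1) \<ge> 1\<close>. It replaces Hoelder's inequality, with \<open>b\<close> left free to be optimised.\<close>

lemma young_split: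
  fixes a b v p :: real
  assumes "0 \<le> a" "0 < v" "0 < b" "1 < p"
  shows "a \<le> b * (v * a powr p) + b powr (- (1 / (p - 1))) * v powr (- (1 / (p - 1)))"
proof -
  define w where "w = b * v"
  have w: "0 < w" using assms by (simp add: w_def)
  have "a \<le> w * a powr p + w powr (- (1 / (p - 1)))"
  proof (cases "a \<le> w powr (- (1 / (p - 1)))")
    case True
    then show ?thesis using w by (intro add_increasing) auto
  next
    case False
    then have a: "0 < a" using w by (meson not_le order.strict_trans1 powr_ge_zero)
    have "1 / w = (w powr (- (1 / (p - 1)))) powr (p - 1)"
      using w assms unfolding powr_powr by (simp add: powr_minus_divide)
    also have "\<dots> \<le> a powr (p - 1)"
      using False assms by (intro powr_mono2) auto
    finally have "1 \<le> w * a powr (p - 1)"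
      using w by (simp add: field_simps)
    then have "a * 1 \<le> a * (w * a powr (p - 1))"
      using a by (intro mult_left_mono) auto
    also have "\<dots> = w * a powr p"
      using a by (simp add: powr_diff)
    finally show ?thesis using w by (intro add_increasing2) auto
  qed
  then show ?thesis
    using assms by (simp add: w_def powr_mult mult_ac)
qed

lemma weight_ball_integral_pos:
  fixes \<nu> :: "real^'n \<Rightarrow> real"
  assumes "locally_integrable \<nu>" "AE x in lebesgue. 0 < \<nu> x" "0 < r"
  shows "(\<integral>\<^sup>+y\<in>ball x r. ennreal (\<nu> y) \<partial>lebesgue) = ennreal (LINT y:ball x r|lebesgue. \<nu> y)"
    and "0 < (LINT y:ball x r|lebesgue. \<nu> y)"
proof -
  have [measurable]: "\<nu> \<in> borel_measurable lebesgue"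
    using locally_integrable_borel_measurable[OF assms(1)] .
  have int: "integrable lebesgue (\<lambda>y. indicator (ball x r) y *\<^sub>R \<nu> y)"
    using locally_integrable_ball[OF assms(1)] by (simp add: set_integrable_def)
  have "(\<integral>\<^sup>+y\<in>ball x r. ennreal (\<nu> y) \<partial>lebesgue) = (\<integral>\<^sup>+y. ennreal (indicator (ball x r) y *\<^sub>R \<nu> y) \<partial>lebesgue)"
    by (intro nn_integral_cong) (auto simp: indicator_def)
  also have "\<dots> = ennreal (LINT y|lebesgue. indicator (ball x r) y *\<^sub>R \<nu> y)"
  proof (rule nn_integral_eq_integral[OF int])
    show "AE y in lebesgue. 0 \<le> indicator (ball x r) y *\<^sub>R \<nu> y"
      using assms(2) by eventually_elim (simp add: indicator_def)
  qed
  finally show eq: "(\<integral>\<^sup>+y\<in>ball x r. ennreal (\<nu> y) \<partial>lebesgue) = ennreal (LINT y:ball x r|lebesgue. \<nu> y)"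
    by (simp add: set_lebesgue_integral_def)
  have "(\<integral>\<^sup>+y\<in>ball x r. ennreal (\<nu> y) \<partial>lebesgue) \<noteq> 0"
  proof
    assume 0: "(\<integral>\<^sup>+y\<in>ball x r. ennreal (\<nu> y) \<partial>lebesgue) = 0"
    have "(\<lambda>y. ennreal (\<nu> y) * indicator (ball x r) y) \<in> borel_measurable lebesgue"
      by (intro borel_measurable_times_ennreal borel_measurable_indicator) auto
    from nn_integral_0_iff_AE[OF this] 0 
    have "AE y in lebesgue. ennreal (\<nu> y) * indicator (ball x r) y = 0" by simp
    with assms(2) have "AE y in lebesgue. y \<notin> ball x r"
      by eventually_elim (auto simp: indicator_def split: if_splits)
    then have "emeasure lebesgue (ball x r) = 0"
      by (subst (asm) AE_iff_measurable[of "ball x r"]) auto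
    moreover have "0 < unit_ball_vol (real CARD('n)) * r ^ CARD('n)"
      using assms(3) by simp
    ultimately show False
      using emeasure_lebesgue_ball[of r x] assms(3) by (metis ennreal_eq_0_iff less_imp_le not_le)
  qed
  then show "0 < (LINT y:ball x r|lebesgue. \<nu> y)"
    unfolding eq by (simp add: ennreal_eq_0_iff not_le)
qed

text \<open>Let \<open>B\<close> be the ball of radius \<open>r\<close>. For \<open>p = 1\<close> the weight is at least a multiple of its average over \<open>B\<close>
  almost everywhere on \<open>B\<close>, hence at least a multiple of \<open>1 / \<bar>B\<bar>\<close>, because its mass on \<open>B\<close> is at least that on
  \<open>ball x e\<close>; so \<open>\<bar>u\<bar>\<close> is at most a multiple of \<open>\<bar>B\<bar> * \<nu> * \<bar>u\<bar>\<close> there. For \<open>p > 1\<close> the condition bounds the mass of the dual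
  weight on \<open>B\<close> by a multiple of \<open>\<bar>B\<bar> powr p'\<close>, and \<open>young_split\<close> with \<open>b = \<bar>B\<bar>\<close> balances the two terms.\<close>

lemma muckenhoupt_ball_growth:
  fixes \<nu> u :: "real^'n \<Rightarrow> real"
  assumes p: "1 \<le> p" and \<nu>: "\<nu> \<in> muckenhoupt p" and u: "u \<in> weighted_Lp p \<nu>" and e: "0 < e"
  shows "\<exists>K\<ge>0. \<forall>r\<ge>e. (\<integral>\<^sup>+y\<in>ball x r. ennreal \<bar>u y\<bar> \<partial>lebesgue) \<le> ennreal (K * r ^ CARD('n))"
proof -
  let ?w = "unit_ball_vol (real CARD('n))"
  have li: "locally_integrable \<nu>" and pos: "AE x in lebesgue. 0 < \<nu> x"
    using \<nu> by (auto simp: muckenhoupt_def)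
  have [measurable]: "\<nu> \<in> borel_measurable lebesgue" "u \<in> borel_measurable lebesgue"
    using locally_integrable_borel_measurable[OF li] u by (auto simp: weighted_Lp_def)
  have "(\<integral>\<^sup>+y. ennreal (\<bar>u y\<bar> powr p) \<partial>density lebesgue (\<lambda>x. ennreal (\<nu> x))) < \<infinity>"
    using u unfolding weighted_Lp_def integrable_iff_bounded by simp
  then have "(\<integral>\<^sup>+y. ennreal (\<nu> y) * ennreal (\<bar>u y\<bar> powr p) \<partial>lebesgue) < \<infinity>"
    by (simp add: nn_integral_density)
  then obtain N where N: "0 \<le> N" "(\<integral>\<^sup>+y. ennreal (\<nu> y) * ennreal (\<bar>u y\<bar> powr p) \<partial>lebesgue) = ennreal N"
    by (cases "(\<integral>\<^sup>+y. ennreal (\<nu> y) * ennreal (\<bar>u y\<bar> powr p) \<partial>lebesgue)") auto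
  define c where "c r = (LINT y:ball x r|lebesgue. \<nu> y)" for r
  have c: "(\<integral>\<^sup>+y\<in>ball x r. ennreal (\<nu> y) \<partial>lebesgue) = ennreal (c r)" "0 < c r" if "0 < r" for r
    unfolding c_def using weight_ball_integral_pos[OF li pos that] .
  have c_mono: "c e \<le> c r" if "e \<le> r" for r
  proof -
    have "(\<integral>\<^sup>+y\<in>ball x e. ennreal (\<nu> y) \<partial>lebesgue) \<le> (\<integral>\<^sup>+y\<in>ball x r. ennreal (\<nu> y) \<partial>lebesgue)"
      using that by (intro nn_integral_mono mult_left_mono) (auto simp: indicator_def)
    then show ?thesis
      using c[of e] c[of r] e that by (simp add: ennreal_le_iff)
  qed
  define b where "b r = ?w * r ^ CARD('n)" for r
  have b: "0 < b r" "measure lebesgue (ball x r) = b r" "emeasure lebesgue (ball x r) = ennreal (b r)" if "0 < r" for r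
    using that measure_lebesgue_ball[of r x] emeasure_lebesgue_ball[of r x] by (simp_all add: b_def)
  from \<nu> p consider (one) C where "p = 1" "0 < C" "AE x in lebesgue. maximal_function \<nu> x \<le> ennreal (C * \<nu> x)"
    | (gt) C where "1 < p" "0 < C" "\<And>r. 0 < r \<Longrightarrow> set_integrable lebesgue (ball x r) (\<lambda>y. \<nu> y powr (1 - p / (p - 1)))"
      "\<And>r. 0 < r \<Longrightarrow> ball_average x r \<nu> powr (1 / p) *
            ball_average x r (\<lambda>y. \<nu> y powr (1 - p / (p - 1))) powr (1 / (p / (p - 1))) \<le> C"
    unfolding muckenhoupt_def Let_def by blast
  then show ?thesis
  proof cases
    case one
    have "(\<integral>\<^sup>+y\<in>ball x r. ennreal \<bar>u y\<bar> \<partial>lebesgue) \<le> ennreal (C * ?w * N / c e * r ^ CARD('n))" if r: "e \<le> r" for r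
    proof -
      have r0: "0 < r" using e r by simp
      \<comment> \<open>The maximal function is uncentred, so \<open>ball x r\<close> competes in its supremum at each of its points.\<close>
      have "AE y in lebesgue. y \<in> ball x r \<longrightarrow> c e \<le> C * b r * \<nu> y"
        using one(3) pos
      proof eventually_elim
        case (elim y)
        show ?case
        proof
          assume y: "y \<in> ball x r"
          have "ennreal (c e) \<le> ennreal (c r)" using c_mono[OF r] by (rule ennreal_leI)
          also have "\<dots> = (\<integral>\<^sup>+y\<in>ball x r. ennreal (\<nu> y) \<partial>lebesgue)" using c[OF r0] by simp
          also have "\<dots> \<le> (\<integral>\<^sup>+y\<in>ball x r. ennreal (norm (\<nu> y)) \<partial>lebesgue)"
            by (intro nn_integral_mono mult_right_mono ennreal_leI) auto
          also have "\<dots> \<le> maximal_function \<nu> y * ennreal (b r)"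
            unfolding b_def by (rule nn_integral_ball_le_maximal_function[OF y])
          also have "\<dots> \<le> ennreal (C * \<nu> y) * ennreal (b r)"
            by (intro mult_right_mono elim) auto
          also have "\<dots> = ennreal (C * b r * \<nu> y)"
            using elim one(2) b(1)[OF r0] by (simp add: ennreal_mult[symmetric] mult_ac)
          finally show "c e \<le> C * b r * \<nu> y"
            using elim one(2) b(1)[OF r0] by (subst (asm) ennreal_le_iff) auto
        qed
      qed
      then have "AE y in lebesgue. ennreal \<bar>u y\<bar> * indicator (ball x r) y
          \<le> ennreal (C * b r / c e) * (ennreal (\<nu> y) * ennreal (\<bar>u y\<bar> powr p))"
        using pos
      proof eventually_elim
        case (elim y)
        show ?case
        proof (cases "y \<in> ball x r")
          case True
          then have "1 \<le> C * b r / c e * \<nu> y"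
            using elim c(2)[OF e] by (simp add: field_simps)
          then have "\<bar>u y\<bar> * 1 \<le> \<bar>u y\<bar> * (C * b r / c e * \<nu> y)"
            by (rule mult_left_mono) simp
          then show ?thesis
            using True elim one b(1)[OF r0] c(2)[OF e]
            by (simp add: ennreal_mult[symmetric] mult_ac ennreal_leI)
        qed simp
      qed
      then have "(\<integral>\<^sup>+y\<in>ball x r. ennreal \<bar>u y\<bar> \<partial>lebesgue)
          \<le> (\<integral>\<^sup>+y. ennreal (C * b r / c e) * (ennreal (\<nu> y) * ennreal (\<bar>u y\<bar> powr p)) \<partial>lebesgue)"
        by (rule nn_integral_mono_AE)
      also have "\<dots> = ennreal (C * b r / c e) * ennreal N"
        by (simp add: nn_integral_cmult N(2))
      also have "\<dots> = ennreal (C * ?w * N / c e * r ^ CARD('n))"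
        using one b(1)[OF r0] c(2)[OF e] N(1) by (simp add: ennreal_mult[symmetric] b_def mult_ac)
      finally show ?thesis .
    qed
    moreover have "0 \<le> C * ?w * N / c e" using one N c(2)[OF e] by simp
    ultimately show ?thesis by blast
  next
    case gt
    \<comment> \<open>In terms of \<open>q\<close> the conjugate exponent is \<open>1 + q\<close> and the dual weight is \<open>\<nu> powr (- q)\<close>.\<close>
    define q where "q = 1 / (p - 1)"
    have q: "0 < q" "1 - p / (p - 1) = - q" "p / (p - 1) = 1 + q" "(1 + q) / p = q"
      using gt(1) by (auto simp: q_def field_simps)
    define S where "S r = (LINT y:ball x r|lebesgue. \<nu> y powr (- q))" for r
    have S_nonneg: "0 \<le> S r" for r
      unfolding S_def set_lebesgue_integral_def by (rule Bochner_Integration.integral_nonneg) simp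
    have S_eq: "(\<integral>\<^sup>+y\<in>ball x r. ennreal (\<nu> y powr (- q)) \<partial>lebesgue) = ennreal (S r)" if "0 < r" for r
    proof -
      have "(\<integral>\<^sup>+y\<in>ball x r. ennreal (\<nu> y powr (- q)) \<partial>lebesgue)
        = (\<integral>\<^sup>+y. ennreal (indicator (ball x r) y *\<^sub>R \<nu> y powr (- q)) \<partial>lebesgue)"
        by (intro nn_integral_cong) (auto simp: indicator_def)
      also have "\<dots> = ennreal (S r)"
        unfolding S_def set_lebesgue_integral_def
        using gt(3)[OF that] unfolding q(2) set_integrable_def by (rule nn_integral_eq_integral) simp
      finally show ?thesis .
    qed
    have S_le: "S r \<le> b r powr (1 + q) * (C powr (1 + q) * c e powr (- q))" if r: "e \<le> r" for r
    proof -
      have r0: "0 < r" using e r by simp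
      note b = b[OF r0]
      have "(c e / b r) powr (1 / p) * (S r / b r) powr (1 / (1 + q)) 
          \<le> (c r / b r) powr (1 / p) * (S r / b r) powr (1 / (1 + q))"
        using c_mono[OF r] c(2)[OF e] b gt(1) by (intro mult_right_mono powr_mono2 divide_right_mono) auto
      also have "\<dots> \<le> C"
        using gt(4)[OF r0] unfolding ball_average_def q(2) unfolding q(3) b(2) S_def c_def .
      finally have "((c e / b r) powr (1 / p) * (S r / b r) powr (1 / (1 + q))) powr (1 + q) \<le> C powr (1 + q)"
        using q by (intro powr_mono2) auto
      moreover have "((c e / b r) powr (1 / p) * (S r / b r) powr (1 / (1 + q))) powr (1 + q)
          = (c e / b r) powr q * (S r / b r)"
        using q S_nonneg[of r] b c(2)[OF e] by (simp add: powr_mult powr_powr)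
      ultimately have "(c e / b r) powr q * (S r / b r) \<le> C powr (1 + q)" by simp
      moreover have "(c e / b r) powr q = c e powr q / b r powr q"
        by (rule powr_divide)
      ultimately have "S r * c e powr q \<le> C powr (1 + q) * (b r * b r powr q)"
        using b by (simp add: field_simps)
      then show ?thesis
        using b c(2)[OF e] by (simp add: powr_add powr_minus_divide field_simps)
    qed
    have "(\<integral>\<^sup>+y\<in>ball x r. ennreal \<bar>u y\<bar> \<partial>lebesgue)
        \<le> ennreal (?w * (N + C powr (1 + q) * c e powr (- q)) * r ^ CARD('n))" if r: "e \<le> r" for r
    proof -
      have r0: "0 < r" using e r by simp
      note b = b[OF r0]
      have "AE y in lebesgue. ennreal \<bar>u y\<bar> * indicator (ball x r) y
          \<le> ennreal (b r) * (ennreal (\<nu> y) * ennreal (\<bar>u y\<bar> powr p))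
            + ennreal (b r powr (- q)) * (ennreal (\<nu> y powr (- q)) * indicator (ball x r) y)"
        using pos
      proof eventually_elim
        case (elim y)
        show ?case
        proof (cases "y \<in> ball x r")
          case True
          have "\<bar>u y\<bar> \<le> b r * (\<nu> y * \<bar>u y\<bar> powr p) + b r powr (- q) * \<nu> y powr (- q)"
            unfolding q_def using young_split[of "\<bar>u y\<bar>" "\<nu> y" "b r" p] elim b(1) gt(1) by simp
          then have "ennreal \<bar>u y\<bar> \<le> ennreal (b r * (\<nu> y * \<bar>u y\<bar> powr p) + b r powr (- q) * \<nu> y powr (- q))"
            by (rule ennreal_leI)
          then show ?thesis
            using True elim b(1) by (simp add: ennreal_mult ennreal_plus)
        qed simp
      qed
      then have "(\<integral>\<^sup>+y\<in>ball x r. ennreal \<bar>u y\<bar> \<partial>lebesgue)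
          \<le> (\<integral>\<^sup>+y. ennreal (b r) * (ennreal (\<nu> y) * ennreal (\<bar>u y\<bar> powr p))
            + ennreal (b r powr (- q)) * (ennreal (\<nu> y powr (- q)) * indicator (ball x r) y) \<partial>lebesgue)"
        by (rule nn_integral_mono_AE)
      also have "\<dots> = (\<integral>\<^sup>+y. ennreal (b r) * (ennreal (\<nu> y) * ennreal (\<bar>u y\<bar> powr p)) \<partial>lebesgue)
            + (\<integral>\<^sup>+y. ennreal (b r powr (- q)) * (ennreal (\<nu> y powr (- q)) * indicator (ball x r) y) \<partial>lebesgue)"
        by (rule nn_integral_add) (intro borel_measurable_times_ennreal borel_measurable_indicator; simp)+
      also have "\<dots> = ennreal (b r) * ennreal N + ennreal (b r powr (- q)) * ennreal (S r)"
        by (subst (1 2) nn_integral_cmult)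
          (simp_all add: N(2) S_eq[OF r0] borel_measurable_times_ennreal borel_measurable_indicator)
      also have "\<dots> = ennreal (b r * N + b r powr (- q) * S r)"
        using b(1) N(1) S_nonneg by (simp add: ennreal_mult ennreal_plus)
      also have "\<dots> \<le> ennreal (b r * N + b r powr (- q) * (b r powr (1 + q) * (C powr (1 + q) * c e powr (- q))))"
        using S_le[OF r] by (intro ennreal_leI add_left_mono mult_left_mono) auto
      also have "b r powr (- q) * (b r powr (1 + q) * (C powr (1 + q) * c e powr (- q)))
          = b r * (C powr (1 + q) * c e powr (- q))"
        using b(1) by (simp add: powr_add powr_minus_divide)
      finally show ?thesis
        by (simp add: b_def algebra_simps)
    qed
    moreover have "0 \<le> ?w * (N + C powr (1 + q) * c e powr (- q))" using N by simp
    ultimately show ?thesis by blast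
  qed
qed

section \<open>Layer-cake decomposition of the truncated kernel\<close>

lemma nn_integral_powr_tail:
  fixes a \<rho> :: real
  assumes "0 < a" "0 < \<rho>"
  shows "(\<integral>\<^sup>+r\<in>{\<rho><..}. ennreal (a * r powr (- a - 1)) \<partial>lborel) = ennreal (\<rho> powr (- a))"
proof -
  have "(\<integral>\<^sup>+r\<in>{\<rho><..}. ennreal (a * r powr (- a - 1)) \<partial>lborel)
      = (\<integral>\<^sup>+r. ennreal (a * r powr (- a - 1)) * indicator {\<rho>..} r \<partial>lborel)"
    using AE_lborel_singleton[of \<rho>]
    by (intro nn_integral_cong_AE) (auto elim!: eventually_mono simp: indicator_def)
  also have "\<dots> = ennreal (0 - - (\<rho> powr (- a)))"
  proof (rule nn_integral_FTC_atLeast)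
    show "DERIV (\<lambda>r. - (r powr (- a))) r :> a * r powr (- a - 1)" if "\<rho> \<le> r" for r
      using that assms by (auto intro!: derivative_eq_intros simp: powr_diff)
    have "((\<lambda>r. r powr (- a)) \<longlongrightarrow> 0) at_top"
      using assms by (intro tendsto_neg_powr filterlim_ident) auto
    then show "((\<lambda>r. - (r powr (- a))) \<longlongrightarrow> 0) at_top"
      using tendsto_minus by fastforce
  qed (use assms in auto)
  finally show ?thesis by simp
qed

lemma integral_powr_tail:
  fixes a \<rho> :: real
  assumes "0 < a" "0 < \<rho>"
  shows "(LINT r|lborel. indicator {\<rho><..} r * (a * r powr (- a - 1))) = \<rho> powr (- a)"
proof -
  have "(\<integral>\<^sup>+r. ennreal (indicator {\<rho><..} r * (a * r powr (- a - 1))) \<partial>lborel)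
      = (\<integral>\<^sup>+r\<in>{\<rho><..}. ennreal (a * r powr (- a - 1)) \<partial>lborel)"
    by (intro nn_integral_cong) (auto simp: indicator_def)
  then have "has_bochner_integral lborel (\<lambda>r. indicator {\<rho><..} r * (a * r powr (- a - 1))) (\<rho> powr (- a))"
    using assms unfolding nn_integral_powr_tail[OF assms]
    by (intro has_bochner_integral_nn_integral) auto
  then show ?thesis by (rule has_bochner_integral_integral_eq)
qed

text \<open>Both claims are Fubini for the function \<open>k y r\<close> that is \<open>f y * (a * r powr (- a - 1))\<close> on
  \<open>e < norm y < r\<close> and zero elsewhere; by Tonelli, the hypothesis makes it integrable.\<close>

lemma layer_cake_truncated:
  fixes f :: "real^'n \<Rightarrow> real"
  assumes f: "f \<in> borel_measurable lebesgue" and e: "0 < e" and a: "0 < a"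
    and fin: "(\<integral>\<^sup>+r\<in>{e<..}. ennreal (a * r powr (- a - 1)) * (\<integral>\<^sup>+y\<in>ball 0 r. ennreal \<bar>f y\<bar> \<partial>lebesgue) \<partial>lborel) < \<infinity>"
  shows "set_integrable lebesgue {y. e < norm y} (\<lambda>y. f y / norm y powr a)"
    and "(LINT y:{y. e < norm y}|lebesgue. f y / norm y powr a)
      = (LINT r|lborel. indicator {e<..} r * (a * r powr (- a - 1)) * (LINT y:{y. e < norm y \<and> norm y < r}|lebesgue. f y))"
proof -
  interpret sigma_finite_measure "lebesgue :: (real^'n) measure" by (rule sigma_finite_lebesgue)
  interpret pair_sigma_finite "lebesgue :: (real^'n) measure" "lborel :: real measure" ..
  note [measurable] = f
  have [measurable]: "(\<lambda>y::real^'n. norm y) \<in> borel_measurable lebesgue"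
    by (rule measurable_completion) simp
  define k where "k y r = (if e < norm y \<and> norm y < r then f y * (a * r powr (- a - 1)) else 0)" for y r
  have k_meas [measurable]: "(\<lambda>p. k (fst p) (snd p)) \<in> borel_measurable (lebesgue \<Otimes>\<^sub>M lborel)"
    unfolding k_def by measurable
  have inner_r: "(LINT r|lborel. k y r) = indicator {y. e < norm y} y *\<^sub>R (f y / norm y powr a)" for y
  proof (cases "e < norm y")
    case True
    then have "k y = (\<lambda>r. f y * (indicator {norm y<..} r * (a * r powr (- a - 1))))"
      by (auto simp: k_def fun_eq_iff)
    moreover have "0 < norm y" using True e by linarith
    ultimately have "(LINT r|lborel. k y r) = f y * norm y powr (- a)"
      by (simp only: integral_mult_right_zero integral_powr_tail[OF a])
    then show ?thesis using True by (simp add: powr_minus_divide)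
  next
    case False
    then have "k y = (\<lambda>r. 0)" by (auto simp: k_def)
    then show ?thesis using False by simp
  qed
  have "(\<integral>\<^sup>+p. ennreal (norm (k (fst p) (snd p))) \<partial>(lebesgue \<Otimes>\<^sub>M lborel))
      = (\<integral>\<^sup>+r. (\<integral>\<^sup>+y. ennreal \<bar>k y r\<bar> \<partial>lebesgue) \<partial>lborel)"
    by (subst nn_integral_snd[symmetric]) auto
  also have "\<dots> \<le> (\<integral>\<^sup>+r\<in>{e<..}. ennreal (a * r powr (- a - 1)) * (\<integral>\<^sup>+y\<in>ball 0 r. ennreal \<bar>f y\<bar> \<partial>lebesgue) \<partial>lborel)"
  proof (rule nn_integral_mono)
    fix r :: real
    show "(\<integral>\<^sup>+y. ennreal \<bar>k y r\<bar> \<partial>lebesgue) \<le> 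
      ennreal (a * r powr (- a - 1)) * (\<integral>\<^sup>+y\<in>ball 0 r. ennreal \<bar>f y\<bar> \<partial>lebesgue) * indicator {e<..} r"
    proof (cases "e < r")
      case True
      have "(\<integral>\<^sup>+y. ennreal \<bar>k y r\<bar> \<partial>lebesgue)
          \<le> (\<integral>\<^sup>+y. ennreal (a * r powr (- a - 1)) * (ennreal \<bar>f y\<bar> * indicator (ball 0 r) y) \<partial>lebesgue)"
        using a by (intro nn_integral_mono) (auto simp: k_def abs_mult mult.commute ennreal_mult)
      also have "\<dots> = ennreal (a * r powr (- a - 1)) * (\<integral>\<^sup>+y\<in>ball 0 r. ennreal \<bar>f y\<bar> \<partial>lebesgue)"
        by (rule nn_integral_cmult) (intro borel_measurable_times_ennreal borel_measurable_indicator; simp)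
      finally show ?thesis using True by simp
    next
      case False
      then have "k y r = 0" for y by (auto simp: k_def)
      then show ?thesis by simp
    qed
  qed
  finally have int: "integrable (lebesgue \<Otimes>\<^sub>M lborel) (\<lambda>p. k (fst p) (snd p))"
    using fin by (intro integrableI_bounded k_meas) (rule order.strict_trans1)
  then have int': "integrable (lebesgue \<Otimes>\<^sub>M lborel) (\<lambda>(y, r). k y r)" by (simp add: case_prod_beta')
  show "set_integrable lebesgue {y. e < norm y} (\<lambda>y. f y / norm y powr a)"
    using integrable_fst'[OF int] by (simp add: inner_r set_integrable_def)
  have "(LINT y:{y. e < norm y}|lebesgue. f y / norm y powr a) = (LINT y|lebesgue. LINT r|lborel. k y r)"
    unfolding inner_r set_lebesgue_integral_def ..
  also have "\<dots> = (LINT r|lborel. LINT y|lebesgue. k y r)"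
    by (rule Fubini_integral[OF int', symmetric])
  also have "\<dots> = (LINT r|lborel. indicator {e<..} r * (a * r powr (- a - 1)) * (LINT y:{y. e < norm y \<and> norm y < r}|lebesgue. f y))"
  proof (rule Bochner_Integration.integral_cong[OF refl])
    fix r :: real
    show "(LINT y|lebesgue. k y r) = indicator {e<..} r * (a * r powr (- a - 1)) * (LINT y:{y. e < norm y \<and> norm y < r}|lebesgue. f y)"
    proof (cases "e < r")
      case True
      have "(\<lambda>y. k y r) = (\<lambda>y. (a * r powr (- a - 1)) * (indicator {y. e < norm y \<and> norm y < r} y *\<^sub>R f y))"
        by (auto simp: k_def fun_eq_iff)
      then show ?thesis
        using True by (simp only: integral_mult_right_zero set_lebesgue_integral_def) simp
    next
      case False
      then have "(\<lambda>y. k y r) = (\<lambda>y. 0)" by (auto simp: k_def)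
      then show ?thesis using False by simp
    qed
  qed
  finally show "(LINT y:{y. e < norm y}|lebesgue. f y / norm y powr a)
      = (LINT r|lborel. indicator {e<..} r * (a * r powr (- a - 1)) * (LINT y:{y. e < norm y \<and> norm y < r}|lebesgue. f y))" .
qed

text \<open>Growth of order \<open>n + 2\<close> up to radius \<open>1\<close> and of order \<open>n\<close> beyond it leaves the integrals of
  \<open>r powr (1 - 2 * s)\<close> over \<open>{e..1}\<close> and of \<open>r powr (- 1 - 2 * s)\<close> over \<open>{1<..}\<close>.\<close>

lemma nn_integral_two_scales:
  fixes s e A B :: real
  assumes s: "0 < s" "s < 1" and e: "0 < e" and AB: "0 \<le> A" "0 \<le> B" and a: "0 < a" "a = real n + 2 * s"
    and G: "\<And>r. e < r \<Longrightarrow> r \<le> 1 \<Longrightarrow> G r \<le> ennreal (A * r ^ (n + 2))"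
      "\<And>r. e < r \<Longrightarrow> 1 \<le> r \<Longrightarrow> G r \<le> ennreal (B * r ^ n)"
  shows "(\<integral>\<^sup>+r\<in>{e<..}. ennreal (a * r powr (- a - 1)) * G r \<partial>lborel) \<le> ennreal (a * (A / (2 - 2 * s) + B / (2 * s)))"
proof -
  have "(\<integral>\<^sup>+r\<in>{e<..}. ennreal (a * r powr (- a - 1)) * G r \<partial>lborel)
      \<le> (\<integral>\<^sup>+r. ennreal (a * A) * (ennreal (r powr (1 - 2 * s)) * indicator {e..1} r)
          + ennreal (a * B / (2 * s)) * (ennreal (2 * s * r powr (- (2 * s) - 1)) * indicator {1<..} r) \<partial>lborel)"
  proof (rule nn_integral_mono)
    fix r :: real
    show "ennreal (a * r powr (- a - 1)) * G r * indicator {e<..} r \<le>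
      ennreal (a * A) * (ennreal (r powr (1 - 2 * s)) * indicator {e..1} r)
          + ennreal (a * B / (2 * s)) * (ennreal (2 * s * r powr (- (2 * s) - 1)) * indicator {1<..} r)"
    proof (cases "e < r")
      case True
      then have r: "0 < r" using e by simp
      have p1: "r powr (- a - 1) * r ^ (n + 2) = r powr (1 - 2 * s)"
        using r by (simp add: a powr_realpow[symmetric] powr_add[symmetric] del: power_Suc)
      have p2: "r powr (- a - 1) * r ^ n = r powr (- (2 * s) - 1)"
        using r by (simp add: a powr_realpow[symmetric] powr_add[symmetric])
      show ?thesis
      proof (cases "r \<le> 1")
        case le: True
        have "ennreal (a * r powr (- a - 1)) * G r \<le> ennreal (a * r powr (- a - 1)) * ennreal (A * r ^ (n + 2))"
          by (intro mult_left_mono G True le) simp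
        also have "\<dots> = ennreal (a * A * (r powr (- a - 1) * r ^ (n + 2)))"
          using a AB r by (subst ennreal_mult[symmetric]) (auto simp: mult_ac)
        also have "\<dots> = ennreal (a * A) * ennreal (r powr (1 - 2 * s))"
          unfolding p1 using a AB by (intro ennreal_mult) auto
        finally show ?thesis using True le by simp
      next
        case gt: False
        have "ennreal (a * r powr (- a - 1)) * G r \<le> ennreal (a * r powr (- a - 1)) * ennreal (B * r ^ n)"
          using gt by (intro mult_left_mono G True) auto
        also have "\<dots> = ennreal (a * B * (r powr (- a - 1) * r ^ n))"
          using a AB r by (subst ennreal_mult[symmetric]) (auto simp: mult_ac)
        also have "\<dots> = ennreal (a * B / (2 * s)) * ennreal (2 * s * r powr (- (2 * s) - 1))"
          unfolding p2 using a AB s by (subst ennreal_mult[symmetric]) auto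
        finally show ?thesis using True gt by simp
      qed
    qed simp
  qed
  also have "\<dots> = ennreal (a * A) * (\<integral>\<^sup>+r\<in>{e..1}. ennreal (r powr (1 - 2 * s)) \<partial>lborel)
      + ennreal (a * B / (2 * s)) * (\<integral>\<^sup>+r\<in>{1<..}. ennreal (2 * s * r powr (- (2 * s) - 1)) \<partial>lborel)"
    by (simp add: nn_integral_add nn_integral_cmult)
  also have "\<dots> \<le> ennreal (a * A) * ennreal (1 / (2 - 2 * s)) + ennreal (a * B / (2 * s)) * ennreal 1"
  proof (intro add_mono mult_left_mono)
    show "(\<integral>\<^sup>+r\<in>{1<..}. ennreal (2 * s * r powr (- (2 * s) - 1)) \<partial>lborel) \<le> ennreal 1"
      using nn_integral_powr_tail[of "2 * s" 1] s by simp
    show "(\<integral>\<^sup>+r\<in>{e..1}. ennreal (r powr (1 - 2 * s)) \<partial>lborel) \<le> ennreal (1 / (2 - 2 * s))"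
    proof (cases "e \<le> 1")
      case True
      have "(\<integral>\<^sup>+r\<in>{e..1}. ennreal (r powr (1 - 2 * s)) \<partial>lborel) = 
          ennreal (1 powr (2 - 2 * s) / (2 - 2 * s) - e powr (2 - 2 * s) / (2 - 2 * s))"
      proof (rule nn_integral_FTC_Icc[OF _ _ _ True])
        show "((\<lambda>r. r powr (2 - 2 * s) / (2 - 2 * s)) has_real_derivative r powr (1 - 2 * s)) (at r)"
          if "r \<in> {e..1}" for r
          using that e s by (auto intro!: derivative_eq_intros)
      qed auto
      also have "\<dots> \<le> ennreal (1 / (2 - 2 * s))" using s by (intro ennreal_leI) simp
      finally show ?thesis .
    qed simp
  qed auto
  also have "\<dots> = ennreal (a * (A / (2 - 2 * s) + B / (2 * s)))"
    using a AB s by (simp add: ennreal_mult[symmetric] ennreal_plus[symmetric] distrib_left del: ennreal_plus)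
  finally show ?thesis .
qed

section \<open>The truncated fractional Laplacian\<close>

lemma ennreal_abs_integral_le:
  fixes f :: "'a \<Rightarrow> real"
  shows "ennreal \<bar>LINT x|M. f x\<bar> \<le> (\<integral>\<^sup>+x. ennreal \<bar>f x\<bar> \<partial>M)"
proof (cases "integrable M f")
  case True
  then show ?thesis using integral_norm_bound_ennreal[OF True] by simp
next
  case False
  then show ?thesis by (simp add: not_integrable_integral_eq)
qed

lemma ball_integral_le_maximal_function:
  fixes u :: "real^'n \<Rightarrow> real"
  assumes "maximal_function u x \<le> ennreal M" "0 \<le> M" "0 < r"
  shows "\<bar>LINT z:ball x r|lebesgue. u z\<bar> \<le> M * (unit_ball_vol CARD('n) * r ^ CARD('n))"
proof -
  have "ennreal \<bar>LINT z:ball x r|lebesgue. u z\<bar> \<le> (\<integral>\<^sup>+z. ennreal \<bar>indicator (ball x r) z *\<^sub>R u z\<bar> \<partial>lebesgue)"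
    unfolding set_lebesgue_integral_def by (rule ennreal_abs_integral_le)
  also have "\<dots> = (\<integral>\<^sup>+z\<in>ball x r. ennreal (norm (u z)) \<partial>lebesgue)"
    by (intro nn_integral_cong) (auto simp: indicator_def)
  also have "\<dots> \<le> maximal_function u x * ennreal (unit_ball_vol CARD('n) * r ^ CARD('n))"
    using assms by (intro nn_integral_ball_le_maximal_function) simp
  also have "\<dots> \<le> ennreal M * ennreal (unit_ball_vol CARD('n) * r ^ CARD('n))"
    by (intro mult_right_mono assms) simp
  also have "\<dots> = ennreal (M * (unit_ball_vol CARD('n) * r ^ CARD('n)))"
    using assms by (intro ennreal_mult[symmetric]) auto
  finally show ?thesis
    using assms by (subst (asm) ennreal_le_iff) auto
qed

text \<open>Convergence along one sequence of radii suffices, because \<open>ball_integral_difference\<close> already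
  controls how the averages vary with the radius.\<close>

definition ball_mean_limit :: "(real^'n \<Rightarrow> real) \<Rightarrow> real^'n \<Rightarrow> bool" where
  "ball_mean_limit u x \<longleftrightarrow> (\<exists>d. (\<forall>k. 0 < d k) \<and> d \<longlonglongrightarrow> 0 \<and>
    (\<lambda>k. (LINT z:ball x (d k)|lebesgue. u z) / measure lebesgue (ball x (d k))) \<longlonglongrightarrow> u x)"

lemma abs_le_maximal_function:
  fixes u :: "real^'n \<Rightarrow> real"
  assumes lim: "ball_mean_limit u x" and M: "maximal_function u x \<le> ennreal M" "0 \<le> M"
  shows "\<bar>u x\<bar> \<le> M"
proof -
  obtain d where d: "\<And>k. 0 < d k" and
    L: "(\<lambda>k. (LINT z:ball x (d k)|lebesgue. u z) / measure lebesgue (ball x (d k))) \<longlonglongrightarrow> u x"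
    using lim unfolding ball_mean_limit_def by blast
  have "\<bar>(LINT z:ball x (d k)|lebesgue. u z) / measure lebesgue (ball x (d k))\<bar> \<le> M" for k
    using ball_integral_le_maximal_function[OF M d[of k]] d[of k] measure_lebesgue_ball[of "d k" x]
    by (simp add: abs_divide abs_mult divide_le_eq)
  then show ?thesis
    using tendsto_rabs[OF L] by (intro LIMSEQ_le_const2) auto
qed

text \<open>Compare the radius \<open>r\<close> with radii \<open>d k\<close> tending to \<open>0\<close>, along which the averages tend to \<open>u x\<close>.\<close>

lemma ball_integral_taylor:
  fixes u :: "real^'n \<Rightarrow> real"
  assumes H: "distributional_hessian u H" and lim: "ball_mean_limit u x" and r: "0 < r"
    and m: "maximal_function H x \<le> ennreal m" "0 \<le> m"
  shows "\<bar>(LINT z:ball x r|lebesgue. u z) - u x * (unit_ball_vol CARD('n) * r ^ CARD('n))\<bar>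
    \<le> CARD('n) * unit_ball_vol CARD('n) / 2 * m * r ^ (CARD('n) + 2)"
proof -
  let ?w = "unit_ball_vol (real CARD('n))" and ?A = "\<lambda>r. (LINT z:ball x r|lebesgue. u z) / r ^ CARD('n)"
  obtain d where d: "\<And>k. 0 < d k" "d \<longlonglongrightarrow> 0" and
    L: "(\<lambda>k. (LINT z:ball x (d k)|lebesgue. u z) / measure lebesgue (ball x (d k))) \<longlonglongrightarrow> u x"
    using lim unfolding ball_mean_limit_def by blast
  have "(\<lambda>k. ?w * ((LINT z:ball x (d k)|lebesgue. u z) / measure lebesgue (ball x (d k)))) \<longlonglongrightarrow> ?w * u x"
    by (intro tendsto_intros L)
  moreover have "?w * ((LINT z:ball x (d k)|lebesgue. u z) / measure lebesgue (ball x (d k))) = ?A (d k)" for k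
  proof -
    have "measure lebesgue (ball x (d k)) = ?w * d k ^ CARD('n)" "?w \<noteq> 0"
      using d(1)[of k] measure_lebesgue_ball[of "d k" x] by (simp_all add: less_imp_neq[symmetric])
    then show ?thesis by (simp only:) simp
  qed
  ultimately have "(\<lambda>k. ?A (d k)) \<longlonglongrightarrow> ?w * u x" by simp
  then have "(\<lambda>k. \<bar>?A r - ?A (d k)\<bar>) \<longlonglongrightarrow> \<bar>?A r - ?w * u x\<bar>"
    by (intro tendsto_intros)
  moreover have "\<forall>\<^sub>F k in sequentially. \<bar>?A r - ?A (d k)\<bar> \<le> CARD('n) * ?w / 2 * m * r\<^sup>2"
    using order_tendstoD(2)[OF d(2) r]
    by eventually_elim (intro ball_integral_difference[OF H d(1) _ m], simp)
  ultimately have "\<bar>?A r - ?w * u x\<bar> \<le> CARD('n) * ?w / 2 * m * r\<^sup>2"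
    by (rule tendsto_upperbound) simp
  then have "\<bar>?A r - ?w * u x\<bar> * r ^ CARD('n) \<le> CARD('n) * ?w / 2 * m * r\<^sup>2 * r ^ CARD('n)"
    using r by (intro mult_right_mono) auto
  moreover have "\<bar>?A r - ?w * u x\<bar> * r ^ CARD('n) = \<bar>(?A r - ?w * u x) * r ^ CARD('n)\<bar>"
    using r by (simp add: abs_mult)
  moreover have "(?A r - ?w * u x) * r ^ CARD('n) = (LINT z:ball x r|lebesgue. u z) - u x * (?w * r ^ CARD('n))"
    using r by (simp add: field_simps)
  ultimately show ?thesis by (simp only: power_add mult_ac)
qed

lemma
  fixes u :: "real^'n \<Rightarrow> real"
  assumes u: "locally_integrable u" and r: "0 < r"
  shows set_integrable_increment: "set_integrable lebesgue (ball 0 r) (\<lambda>y. u (x - y) - u x)"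
    and integral_increment: "(LINT y:ball 0 r|lebesgue. u (x - y) - u x)
      = (LINT z:ball x r|lebesgue. u z) - u x * (unit_ball_vol CARD('n) * r ^ CARD('n))"
    and nn_integral_increment_le: "(\<integral>\<^sup>+y\<in>ball 0 r. ennreal \<bar>u (x - y) - u x\<bar> \<partial>lebesgue)
      \<le> (\<integral>\<^sup>+z\<in>ball x r. ennreal \<bar>u z\<bar> \<partial>lebesgue) + ennreal (\<bar>u x\<bar> * (unit_ball_vol CARD('n) * r ^ CARD('n)))"
proof -
  have u_meas [measurable]: "u \<in> borel_measurable lebesgue"
    using locally_integrable_borel_measurable[OF u] .
  have ux_meas [measurable]: "(\<lambda>y. u (x - y)) \<in> borel_measurable lebesgue"
    by (rule measurable_compose[OF lebesgue_distr_reflect(2) u_meas])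
  have ind: "indicator (ball 0 r) y = indicator (ball x r) (x - y)" for y :: "real^'n"
    by (auto simp: indicator_def dist_norm)
  let ?g = "\<lambda>z. indicator (ball x r) z *\<^sub>R u z"
  have g: "integrable lebesgue ?g"
    using locally_integrable_ball[OF u] by (simp add: set_integrable_def)
  then have "integrable (distr lebesgue lebesgue (\<lambda>y. x - y)) ?g"
    by (simp only: lebesgue_distr_reflect(1))
  then have "integrable lebesgue (\<lambda>y. ?g (x - y))"
    by (subst (asm) integrable_distr_eq[OF lebesgue_distr_reflect(2)]) (use borel_measurable_integrable[OF g] in simp_all)
  then have 1: "set_integrable lebesgue (ball 0 r) (\<lambda>y. u (x - y))"
    by (simp only: set_integrable_def ind)
  have fin: "emeasure lebesgue (ball (0::real^'n) r) < \<infinity>"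
    using r by (simp only: emeasure_lebesgue_ball less_imp_le) simp
  have 2: "set_integrable lebesgue (ball 0 r) (\<lambda>y::real^'n. u x)"
    unfolding set_integrable_def using fin by (intro integrable_scaleR_left integrable_real_indicator) auto
  show "set_integrable lebesgue (ball 0 r) (\<lambda>y. u (x - y) - u x)"
    using 1 2 by (rule set_integral_diff)
  have "(LINT y:ball 0 r|lebesgue. u (x - y) - u x) = (LINT y:ball 0 r|lebesgue. u (x - y)) - (LINT y:ball (0::real^'n) r|lebesgue. u x)"
    using 1 2 by (rule set_integral_diff)
  also have "(LINT y:ball 0 r|lebesgue. u (x - y)) = (LINT z:ball x r|lebesgue. u z)"
    unfolding set_lebesgue_integral_def ind by (rule integral_lebesgue_reflect[OF borel_measurable_integrable[OF g]])
  also have "(LINT y:ball (0::real^'n) r|lebesgue. u x) = measure lebesgue (ball (0::real^'n) r) * u x"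
    unfolding set_lebesgue_integral_def by simp
  also have "measure lebesgue (ball (0::real^'n) r) = unit_ball_vol CARD('n) * r ^ CARD('n)"
    using r by (intro measure_lebesgue_ball) simp
  finally show "(LINT y:ball 0 r|lebesgue. u (x - y) - u x)
      = (LINT z:ball x r|lebesgue. u z) - u x * (unit_ball_vol CARD('n) * r ^ CARD('n))"
    by (simp only: mult_ac)
  have "(\<integral>\<^sup>+y\<in>ball 0 r. ennreal \<bar>u (x - y) - u x\<bar> \<partial>lebesgue)
      \<le> (\<integral>\<^sup>+y. ennreal \<bar>u (x - y)\<bar> * indicator (ball x r) (x - y) + ennreal \<bar>u x\<bar> * indicator (ball 0 r) y \<partial>lebesgue)"
  proof (rule nn_integral_mono)
    fix y
    have "ennreal \<bar>u (x - y) - u x\<bar> \<le> ennreal (\<bar>u (x - y)\<bar> + \<bar>u x\<bar>)"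
      by (intro ennreal_leI) linarith
    then have "ennreal \<bar>u (x - y) - u x\<bar> * indicator (ball 0 r) y \<le> (ennreal \<bar>u (x - y)\<bar> + ennreal \<bar>u x\<bar>) * indicator (ball 0 r) y"
      by (intro mult_right_mono) auto
    then show "ennreal \<bar>u (x - y) - u x\<bar> * indicator (ball 0 r) y
        \<le> ennreal \<bar>u (x - y)\<bar> * indicator (ball x r) (x - y) + ennreal \<bar>u x\<bar> * indicator (ball 0 r) y"
      by (simp only: distrib_right ind)
  qed
  also have "\<dots> = (\<integral>\<^sup>+y. ennreal \<bar>u (x - y)\<bar> * indicator (ball x r) (x - y) \<partial>lebesgue)
      + (\<integral>\<^sup>+y. ennreal \<bar>u x\<bar> * indicator (ball 0 r) y \<partial>(lebesgue :: (real^'n) measure))"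
    unfolding ind[symmetric]
    by (rule nn_integral_add) (intro borel_measurable_times_ennreal borel_measurable_indicator; simp)+
  also have "(\<integral>\<^sup>+y. ennreal \<bar>u (x - y)\<bar> * indicator (ball x r) (x - y) \<partial>lebesgue) = (\<integral>\<^sup>+z\<in>ball x r. ennreal \<bar>u z\<bar> \<partial>lebesgue)"
    by (rule nn_integral_lebesgue_reflect[of "\<lambda>z. ennreal \<bar>u z\<bar> * indicator (ball x r) z"])
      (intro borel_measurable_times_ennreal borel_measurable_indicator; simp)
  also have "(\<integral>\<^sup>+y. ennreal \<bar>u x\<bar> * indicator (ball 0 r) y \<partial>(lebesgue :: (real^'n) measure))
      = ennreal (\<bar>u x\<bar> * (unit_ball_vol CARD('n) * r ^ CARD('n)))"
    using r by (subst nn_integral_cmult_indicator) 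
      (auto simp: emeasure_lebesgue_ball ennreal_mult simp del: emeasure_completion)
  finally show "(\<integral>\<^sup>+y\<in>ball 0 r. ennreal \<bar>u (x - y) - u x\<bar> \<partial>lebesgue)
      \<le> (\<integral>\<^sup>+z\<in>ball x r. ennreal \<bar>u z\<bar> \<partial>lebesgue) + ennreal (\<bar>u x\<bar> * (unit_ball_vol CARD('n) * r ^ CARD('n)))" .
qed

lemma integral_annulus:
  fixes f :: "real^'n \<Rightarrow> real"
  assumes f: "set_integrable lebesgue (ball 0 r) f" and er: "0 < e" "e < r"
  shows "(LINT y:{y. e < norm y \<and> norm y < r}|lebesgue. f y)
    = (LINT y:ball 0 r|lebesgue. f y) - (LINT y:ball 0 e|lebesgue. f y)"
proof -
  have "AE y in lebesgue. y \<notin> sphere (0::real^'n) e"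
    using negligible_sphere[of "0::real^'n" e] by (intro AE_not_in) (simp add: negligible_iff_null_sets)
  then have ae: "AE y in lebesgue. norm (y::real^'n) \<noteq> e" by simp
  have fe: "set_integrable lebesgue (ball 0 e) f"
    by (rule set_integrable_subset[OF f]) (use er in auto)
  have "{y::real^'n. e < norm y \<and> norm y < r} = ball 0 r - cball 0 e" by auto
  then have [measurable]: "{y::real^'n. e < norm y \<and> norm y < r} \<in> sets lebesgue" by simp
  have fa: "set_integrable lebesgue {y. e < norm y \<and> norm y < r} f"
    by (rule set_integrable_subset[OF f]) auto
  have "(LINT y|lebesgue. indicator (ball 0 r) y *\<^sub>R f y) = 
      (LINT y|lebesgue. indicator {y. e < norm y \<and> norm y < r} y *\<^sub>R f y + indicator (ball 0 e) y *\<^sub>R f y)"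
    using f fa fe unfolding set_integrable_def
    by (intro integral_cong_AE borel_measurable_add borel_measurable_integrable)
      (use er in \<open>auto intro!: eventually_mono[OF ae] simp: indicator_def\<close>)
  also have "\<dots> = (LINT y|lebesgue. indicator {y. e < norm y \<and> norm y < r} y *\<^sub>R f y) + (LINT y|lebesgue. indicator (ball 0 e) y *\<^sub>R f y)"
    using fa fe unfolding set_integrable_def by (rule Bochner_Integration.integral_add)
  finally show ?thesis by (simp add: set_lebesgue_integral_def)
qed

text \<open>Both claims feed a growth bound on balls into \<open>nn_integral_two_scales\<close>: the crude bound \<open>L * r ^ n\<close> for
  the integral of \<open>\<bar>u (x - y) - u x\<bar>\<close> gives absolute convergence, the two maximal function bounds for the
  signed integral give the estimate.\<close>

lemma truncated_fractional_integral:
  fixes u :: "real^'n \<Rightarrow> real" and s e :: real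
  assumes H: "distributional_hessian u H" and lim: "ball_mean_limit u x"
    and K: "\<exists>K\<ge>0. \<forall>r\<ge>e. (\<integral>\<^sup>+y\<in>ball x r. ennreal \<bar>u y\<bar> \<partial>lebesgue) \<le> ennreal (K * r ^ CARD('n))"
    and s: "0 < s" "s < 1" and e: "0 < e"
  shows "set_integrable lebesgue {y. e < norm y} (\<lambda>y. (u (x - y) - u x) / norm y powr (real CARD('n) + 2 * s))"
    and "maximal_function H x \<le> ennreal m \<Longrightarrow> maximal_function u x \<le> ennreal M \<Longrightarrow> 0 \<le> m \<Longrightarrow> 0 \<le> M \<Longrightarrow>
      \<bar>LINT y:{y. e < norm y}|lebesgue. (u (x - y) - u x) / norm y powr (real CARD('n) + 2 * s)\<bar>
      \<le> (CARD('n) + 2 * s) * (CARD('n) * unit_ball_vol CARD('n) * m / (2 - 2 * s) + 4 * unit_ball_vol CARD('n) * M / (2 * s))"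
proof -
  let ?w = "unit_ball_vol (real CARD('n))"
  define a where "a = real CARD('n) + 2 * s"
  have a: "0 < a" "a = real CARD('n) + 2 * s" using s by (auto simp: a_def add_nonneg_pos)
  define f where "f y = u (x - y) - u x" for y
  have u: "locally_integrable u" 
    using H unfolding distributional_hessian_def distributional_deriv_def by blast
  have [measurable]: "(\<lambda>y. u (x - y)) \<in> borel_measurable lebesgue"
    by (rule measurable_compose[OF lebesgue_distr_reflect(2) locally_integrable_borel_measurable[OF u]])
  have f_meas: "f \<in> borel_measurable lebesgue" unfolding f_def by measurable
  obtain K where K: "0 \<le> K" "\<And>r. e \<le> r \<Longrightarrow> (\<integral>\<^sup>+y\<in>ball x r. ennreal \<bar>u y\<bar> \<partial>lebesgue) \<le> ennreal (K * r ^ CARD('n))"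
    using K by blast
  define L where "L = K + \<bar>u x\<bar> * ?w"
  have L: "0 \<le> L" using K by (simp add: L_def)
  have growth: "(\<integral>\<^sup>+y\<in>ball 0 r. ennreal \<bar>f y\<bar> \<partial>lebesgue) \<le> ennreal (L * r ^ CARD('n))" if "e < r" for r
  proof -
    have r: "0 < r" using that e by simp
    have "(\<integral>\<^sup>+y\<in>ball 0 r. ennreal \<bar>f y\<bar> \<partial>lebesgue) \<le> 
        (\<integral>\<^sup>+z\<in>ball x r. ennreal \<bar>u z\<bar> \<partial>lebesgue) + ennreal (\<bar>u x\<bar> * (?w * r ^ CARD('n)))"
      unfolding f_def by (rule nn_integral_increment_le[OF u r])
    also have "\<dots> \<le> ennreal (K * r ^ CARD('n)) + ennreal (\<bar>u x\<bar> * (?w * r ^ CARD('n)))"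
      using that by (intro add_right_mono K) auto
    also have "\<dots> = ennreal (L * r ^ CARD('n))"
      using K r by (subst ennreal_plus[symmetric]) (auto simp: L_def algebra_simps)
    finally show ?thesis .
  qed
  have "(\<integral>\<^sup>+r\<in>{e<..}. ennreal (a * r powr (- a - 1)) * (\<integral>\<^sup>+y\<in>ball 0 r. ennreal \<bar>f y\<bar> \<partial>lebesgue) \<partial>lborel)
      \<le> ennreal (a * (L / e\<^sup>2 / (2 - 2 * s) + L / (2 * s)))"
  proof (rule nn_integral_two_scales[OF s e _ L a])
    \<comment> \<open>Radii below \<open>e\<close> do not occur, so \<open>r ^ n \<le> r ^ (n + 2) / e\<^sup>2\<close> supplies the small-scale hypothesis.\<close>
    show "0 \<le> L / e\<^sup>2" using L by simp
    show "(\<integral>\<^sup>+y\<in>ball 0 r. ennreal \<bar>f y\<bar> \<partial>lebesgue) \<le> ennreal (L / e\<^sup>2 * r ^ (CARD('n) + 2))" if "e < r" for r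
    proof (rule order.trans[OF growth[OF that]], rule ennreal_leI)
      have "e\<^sup>2 \<le> r\<^sup>2" using that e by (intro power_mono) auto
      then have "L * r ^ CARD('n) * e\<^sup>2 \<le> L * r ^ CARD('n) * r\<^sup>2"
        using L that e by (intro mult_left_mono mult_nonneg_nonneg) auto
      then show "L * r ^ CARD('n) \<le> L / e\<^sup>2 * r ^ (CARD('n) + 2)"
        using e by (simp add: field_simps power2_eq_square)
    qed
  qed (use growth in auto)
  also have "\<dots> < \<infinity>" by simp
  finally have fin: "(\<integral>\<^sup>+r\<in>{e<..}. ennreal (a * r powr (- a - 1)) * (\<integral>\<^sup>+y\<in>ball 0 r. ennreal \<bar>f y\<bar> \<partial>lebesgue) \<partial>lborel) < \<infinity>" .
  note layer = layer_cake_truncated[OF f_meas e a(1) fin]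
  show "set_integrable lebesgue {y. e < norm y} (\<lambda>y. (u (x - y) - u x) / norm y powr (real CARD('n) + 2 * s))"
    using layer(1) by (simp only: f_def a(2))
  assume m: "maximal_function H x \<le> ennreal m" and M: "maximal_function u x \<le> ennreal M" and nn: "0 \<le> m" "0 \<le> M"
  let ?D = "\<lambda>r. LINT y:ball 0 r|lebesgue. f y"
  let ?An = "\<lambda>r. LINT y:{y. e < norm y \<and> norm y < r}|lebesgue. f y"
  have D_eq: "?D r = (LINT z:ball x r|lebesgue. u z) - u x * (?w * r ^ CARD('n))" if "0 < r" for r
    unfolding f_def by (rule integral_increment[OF u that])
  have D1: "\<bar>?D r\<bar> \<le> CARD('n) * ?w / 2 * m * r ^ (CARD('n) + 2)" if "0 < r" for r
    unfolding D_eq[OF that] by (rule ball_integral_taylor[OF H lim that m nn(1)])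
  have D2: "\<bar>?D r\<bar> \<le> 2 * ?w * M * r ^ CARD('n)" if "0 < r" for r
  proof -
    have "\<bar>u x * (?w * r ^ CARD('n))\<bar> \<le> M * (?w * r ^ CARD('n))"
      using that abs_le_maximal_function[OF lim M nn(2)] by (simp add: abs_mult mult_right_mono)
    then show ?thesis
      using ball_integral_le_maximal_function[OF M nn(2) that] unfolding D_eq[OF that] by (simp add: mult_ac)
  qed
  \<comment> \<open>The layer integral only sees the annulus between \<open>e\<close> and \<open>r\<close>. Both bounds on \<open>?D\<close> increase with the
    radius, so the inner ball costs a factor \<open>2\<close>.\<close>
  have An: "\<bar>?An r\<bar> \<le> \<bar>?D r\<bar> + \<bar>?D e\<bar>" if "e < r" for r
  proof -
    have "0 < r" using that e by simp
    have "?An r = ?D r - ?D e"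
      unfolding f_def using set_integrable_increment[OF u \<open>0 < r\<close>] e that by (rule integral_annulus)
    then show ?thesis by simp
  qed
  have An1: "\<bar>?An r\<bar> \<le> CARD('n) * ?w * m * r ^ (CARD('n) + 2)" if "e < r" for r
  proof -
    have "CARD('n) * ?w / 2 * m * e ^ (CARD('n) + 2) \<le> CARD('n) * ?w / 2 * m * r ^ (CARD('n) + 2)"
      using that e nn by (intro mult_left_mono power_mono mult_nonneg_nonneg) auto
    moreover have "0 < r" using that e by simp
    ultimately have "\<bar>?An r\<bar> \<le> 2 * (CARD('n) * ?w / 2 * m * r ^ (CARD('n) + 2))"
      using An[OF that] D1[of r] D1[OF e] by linarith
    then show ?thesis by simp
  qed
  have An2: "\<bar>?An r\<bar> \<le> 4 * ?w * M * r ^ CARD('n)" if "e < r" for r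
  proof -
    have "2 * ?w * M * e ^ CARD('n) \<le> 2 * ?w * M * r ^ CARD('n)"
      using that e nn by (intro mult_left_mono power_mono mult_nonneg_nonneg) auto
    moreover have "0 < r" using that e by simp
    ultimately have "\<bar>?An r\<bar> \<le> 2 * (2 * ?w * M * r ^ CARD('n))"
      using An[OF that] D2[of r] D2[OF e] by linarith
    then show ?thesis by simp
  qed
  have "ennreal \<bar>LINT y:{y. e < norm y}|lebesgue. f y / norm y powr a\<bar>
      \<le> (\<integral>\<^sup>+r. ennreal \<bar>indicator {e<..} r * (a * r powr (- a - 1)) * ?An r\<bar> \<partial>lborel)"
    unfolding layer(2) by (rule ennreal_abs_integral_le)
  also have "\<dots> = (\<integral>\<^sup>+r\<in>{e<..}. ennreal (a * r powr (- a - 1)) * ennreal \<bar>?An r\<bar> \<partial>lborel)"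
    using a by (intro nn_integral_cong) (auto simp: indicator_def abs_mult ennreal_mult)
  also have "\<dots> \<le> ennreal (a * (CARD('n) * ?w * m / (2 - 2 * s) + 4 * ?w * M / (2 * s)))"
    by (rule nn_integral_two_scales[OF s e _ _ a]) (use nn An1 An2 in \<open>auto intro!: ennreal_leI\<close>)
  finally have "\<bar>LINT y:{y. e < norm y}|lebesgue. f y / norm y powr a\<bar>
      \<le> a * (CARD('n) * ?w * m / (2 - 2 * s) + 4 * ?w * M / (2 * s))"
    using a nn s by (subst (asm) ennreal_le_iff) (auto intro!: mult_nonneg_nonneg add_nonneg_nonneg divide_nonneg_nonneg)
  then show "\<bar>LINT y:{y. e < norm y}|lebesgue. (u (x - y) - u x) / norm y powr (real CARD('n) + 2 * s)\<bar>
      \<le> (CARD('n) + 2 * s) * (CARD('n) * ?w * m / (2 - 2 * s) + 4 * ?w * M / (2 * s))"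
    by (simp only: f_def a(2))
qed

theorem theorem4p6:
  "\<exists>C>0. \<forall>p\<ge>1. \<forall>\<nu> \<in> muckenhoupt p. \<forall>u \<in> weighted_sobolev2 p \<nu>.
     \<forall>H :: real^'n \<Rightarrow> real^'n^'n. distributional_hessian u H \<longrightarrow>
     (AE x in lebesgue.
        (\<forall>s\<in>{0<..<1}. \<forall>\<epsilon>>0. set_integrable lebesgue {y. \<epsilon> < norm y}
           (\<lambda>y. (u (x - y) - u x) / norm y powr (real CARD('n) + 2 * s))) \<and>
        (SUP s\<in>{0<..<1}. SUP \<epsilon>\<in>{0<..}.
           ennreal \<bar>frac_laplacian_const CARD('n) s *
             (LINT y:{y. \<epsilon> < norm y}|lebesgue.
                (u (x - y) - u x) / norm y powr (real CARD('n) + 2 * s))\<bar>)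
          \<le> ennreal C * (maximal_function H x + maximal_function u x))"
proof -
  let ?N = "real CARD('n)" and ?w = "unit_ball_vol (real CARD('n))"
  obtain C0 where C0: "0 < C0" "\<And>s. 0 < s \<Longrightarrow> s < 1 \<Longrightarrow> 0 \<le> frac_laplacian_const CARD('n) s"
    "\<And>s. 0 < s \<Longrightarrow> s < 1 \<Longrightarrow> frac_laplacian_const CARD('n) s \<le> C0 * (s * (1 - s))"
    using frac_laplacian_const_bound[of "CARD('n)"] by (auto simp: Suc_le_eq)
  define C where "C = C0 * ((?N + 2) * (?N * ?w + 2 * ?w))"
  have w: "0 < ?w" by simp
  have C: "0 < C" using C0(1) w unfolding C_def by (intro mult_pos_pos add_nonneg_pos) auto
  show ?thesis
  proof (intro exI[of _ C] conjI C allI ballI impI)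
    fix p \<nu> u and H :: "real^'n \<Rightarrow> real^'n^'n"
    assume p: "1 \<le> p" and \<nu>: "\<nu> \<in> muckenhoupt p" and uS: "u \<in> weighted_sobolev2 p \<nu>"
      and H: "distributional_hessian u H"
    have uL: "u \<in> weighted_Lp p \<nu>" using uS by (simp add: weighted_sobolev2_def)
    have u: "locally_integrable u" 
      using H unfolding distributional_hessian_def distributional_deriv_def by blast
    have "AE x in lebesgue. ball_mean_limit u x"
      using locally_integrable_ball_average_subseq[OF u] by (simp only: ball_mean_limit_def)
    then show "AE x in lebesgue.
        (\<forall>s\<in>{0<..<1}. \<forall>\<epsilon>>0. set_integrable lebesgue {y. \<epsilon> < norm y}
           (\<lambda>y. (u (x - y) - u x) / norm y powr (real CARD('n) + 2 * s))) \<and>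
        (SUP s\<in>{0<..<1}. SUP \<epsilon>\<in>{0<..}.
           ennreal \<bar>frac_laplacian_const CARD('n) s *
             (LINT y:{y. \<epsilon> < norm y}|lebesgue.
                (u (x - y) - u x) / norm y powr (real CARD('n) + 2 * s))\<bar>)
          \<le> ennreal C * (maximal_function H x + maximal_function u x)"
    proof eventually_elim
      case (elim x)
      note tf = truncated_fractional_integral[OF H elim muckenhoupt_ball_growth[OF p \<nu> uL]]
      show ?case
      proof (intro conjI ballI allI impI)
        fix s \<epsilon> :: real assume "s \<in> {0<..<1}" "0 < \<epsilon>"
        then show "set_integrable lebesgue {y. \<epsilon> < norm y}
            (\<lambda>y. (u (x - y) - u x) / norm y powr (real CARD('n) + 2 * s))"
          by (intro tf(1)) auto
      next
        show "(SUP s\<in>{0<..<1}. SUP \<epsilon>\<in>{0<..}.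
           ennreal \<bar>frac_laplacian_const CARD('n) s *
             (LINT y:{y. \<epsilon> < norm y}|lebesgue.
                (u (x - y) - u x) / norm y powr (real CARD('n) + 2 * s))\<bar>)
          \<le> ennreal C * (maximal_function H x + maximal_function u x)"
        proof (cases "maximal_function H x + maximal_function u x = top")
          case True
          show ?thesis using C unfolding True by (simp add: ennreal_mult_top)
        next
          case False
          then obtain m M where mM: "0 \<le> m" "maximal_function H x = ennreal m"
            "0 \<le> M" "maximal_function u x = ennreal M"
            by (cases "maximal_function H x"; cases "maximal_function u x") auto
          show ?thesis
          proof (intro SUP_least)
            fix s \<epsilon> :: real assume "s \<in> {0<..<1}" "\<epsilon> \<in> {0<..}"
            then have s: "0 < s" "s < 1" and e: "0 < \<epsilon>" by auto
            let ?I = "LINT y:{y. \<epsilon> < norm y}|lebesgue. (u (x - y) - u x) / norm y powr (real CARD('n) + 2 * s)"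
            have "\<bar>?I\<bar> \<le> (?N + 2 * s) * (?N * ?w * m / (2 - 2 * s) + 4 * ?w * M / (2 * s))"
              using mM by (intro tf(2) s e) auto
            then have "frac_laplacian_const CARD('n) s * \<bar>?I\<bar> \<le> C0 * (s * (1 - s)) *
                ((?N + 2 * s) * (?N * ?w * m / (2 - 2 * s) + 4 * ?w * M / (2 * s)))"
              using s C0 by (intro mult_mono) auto
            also have "\<dots> = C0 * ((?N + 2 * s) * (s / 2 * (?N * ?w * m) + (1 - s) * (2 * ?w * M)))"
            proof -
              \<comment> \<open>Here the decay of the normalising constant at both endpoints cancels the two singular factors.\<close>
              have "s * (1 - s) * (A / (2 - 2 * s) + B / (2 * s)) = s / 2 * A + (1 - s) / 2 * B" for A B :: real
                using s by (simp add: field_simps)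
              from this[of "?N * ?w * m" "4 * ?w * M"] show ?thesis by (simp add: mult_ac) 
            qed
            also have "\<dots> \<le> C0 * ((?N + 2) * (1 * (?N * ?w * m) + 1 * (2 * ?w * M)))"
              using s C0 mM by (intro mult_left_mono mult_mono add_mono) auto
            also have "\<dots> \<le> C0 * ((?N + 2) * ((?N * ?w + 2 * ?w) * m + (?N * ?w + 2 * ?w) * M))"
            proof -
              have "?N * ?w * m \<le> (?N * ?w + 2 * ?w) * m" "2 * ?w * M \<le> (?N * ?w + 2 * ?w) * M"
                by (rule mult_right_mono; use mM in simp)+
              from add_mono[OF this] C0(1) show ?thesis by (intro mult_left_mono) auto
            qed
            also have "\<dots> = C * (m + M)"
              by (simp add: C_def algebra_simps)
            finally have "ennreal (frac_laplacian_const CARD('n) s * \<bar>?I\<bar>) \<le> ennreal (C * (m + M))"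
              by (rule ennreal_leI)
            then show "ennreal \<bar>frac_laplacian_const CARD('n) s * ?I\<bar> 
                \<le> ennreal C * (maximal_function H x + maximal_function u x)"
              using C0(2)[OF s] C mM by (simp add: abs_mult ennreal_mult ennreal_plus)
          qed
        qed
      qed
    qed
  qed
qed

end
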